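(* Let $k,d$ be positive integers and assume that $k\le d/2$. There exists a connected directed acyclic graph $G=(V,E)$ with $d$ edges and two nodes $s,t\in V$ such that every path from $s$ to $t$ has exactly $k$ edges (the layered graph described in the context), and for which, with the action set $$S=\big\{x\in\{0,1\}^d : \text{the set }\{e\in E: x(e)=1\}\text{ forms a path from } s \text{ to } t\big\},$$ the following holds: against this graph, any (possibly randomized) online learning algorithm for the bandit shortest path problem, i.e. for the bandit combinatorial optimization game with action set $S$ and horizon $T$, must suffer at least $$\widetilde{\Omega}\big(k^{3/2}\sqrt{dT}\big)$$ expected regret in the worst case, that is, against some sequence of loss vectors $\ell_1,\dots,\ell_T\in[0,1]^d$ fixed in advance.
   Context: Coordinates of vectors in $\mathbb{R}^d$ are indexed by the $d$ edges of $G$. The graph: it consists of $k/2$ layers. Each layer has an incoming vertex, with an edge to each of $d/k$ intermediate vertices, each of which has an edge to a common outgoing vertex; the outgoing vertex of a layer is the incoming vertex of the next layer. The incoming vertex of the first layer is $s$ and the outgoing vertex of the last layer is $t$. (This description is for $k$ and $d$ even with $d$ a multiple of $k$, which the paper supposes without loss of generality when constructing the graph.) Bandit combinatorial optimization game with action set $S\subseteq\{0,1\}^d$ and horizon $T$: an oblivious environment fixes loss vectors $\ell_1,\dots,\ell_T\in[0,1]^d$ before the game begins. On each round $\tau=1,\dots,T$ the learner picks, possibly at random, an action $x_\tau\in S$ (depending on its internal randomness and on the losses observed in the previous rounds), incurs the loss $\ell_\tau\cdot x_\tau$ (standard inner product), and observes only the number $\ell_\tau\cdot x_\tau$. The expected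 regret is $$R_T=\mathbb{E}\Big[\sum_{\tau=1}^T\ell_\tau\cdot x_\tau\Big]-\min_{x\in S}\sum_{\tau=1}^T\ell_\tau\cdot x,$$ where the expectation is over the learner's random choices. The notation $\widetilde{\Omega}(\cdot)$ denotes a lower bound up to a universal constant and logarithmic factors.
   Formalization: The bound is proved for horizons T ≥ kd (for much smaller T it fails, since regret is at most kT), with powers of ln T as the logarithmic factors; for k = 1 the graph has parallel edges, as a simple graph would have only one path. *)

theory Defs
  imports
    "HOL-Probability.Probability"
    "Graph_Theory.Graph_Theory"
begin

section \<open>The layered graph\<close>

text \<open>
  \<open>Hub i\<close> is the incoming vertex of layer \<open>i\<close> and, for \<open>i > 0\<close>, also the outgoing vertex of
  layer \<open>i - 1\<close> (layers are counted from 0); \<open>Mid i j\<close> is the \<open>j\<close>-th intermediate vertex of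
  layer \<open>i\<close>. The arc \<open>Enter i j\<close> leads from \<open>Hub i\<close> to \<open>Mid i j\<close>, and \<open>Leave i j\<close> leads from
  \<open>Mid i j\<close> to \<open>Hub (Suc i)\<close>.
\<close>

datatype layer_vertex = Hub nat | Mid nat nat

datatype layer_arc = Enter nat nat | Leave nat nat

fun layer_tail :: "layer_arc \<Rightarrow> layer_vertex" where
  "layer_tail (Enter i j) = Hub i"
| "layer_tail (Leave i j) = Mid i j"

fun layer_head :: "layer_arc \<Rightarrow> layer_vertex" where
  "layer_head (Enter i j) = Mid i j"
| "layer_head (Leave i j) = Hub (Suc i)"

text \<open>Intended for even \<open>k > 0\<close> dividing \<open>d\<close>, where both divisions are exact.\<close>

definition layered_digraph :: "nat \<Rightarrow> nat \<Rightarrow> (layer_vertex, layer_arc) pre_digraph" where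
  "layered_digraph k d =
     \<lparr>verts = {Hub i |i. i \<le> k div 2} \<union> {Mid i j |i j. i < k div 2 \<and> j < d div k},
      arcs = {Enter i j |i j. i < k div 2 \<and> j < d div k} \<union>
             {Leave i j |i j. i < k div 2 \<and> j < d div k},
      tail = layer_tail, head = layer_head\<rparr>"

section \<open>Path indicator vectors\<close>

text \<open>
  A vector in \<open>\<real>\<^sup>d\<close>, with coordinates indexed by the arcs of \<open>G\<close>, is a function on the arc type of
  which only the values on \<open>arcs G\<close> matter. Actions are normalised to be 0 elsewhere, so that
  distinct actions are distinct vectors and the action set is finite.
\<close>

definition inner_on :: "'e set \<Rightarrow> ('e \<Rightarrow> real) \<Rightarrow> ('e \<Rightarrow> real) \<Rightarrow> real" where
  "inner_on E l x = (\<Sum>e\<in>E. l e * x e)"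

definition path_actions :: "('v, 'e) pre_digraph \<Rightarrow> 'v \<Rightarrow> 'v \<Rightarrow> ('e \<Rightarrow> real) set" where
  "path_actions G s t =
     {x. (\<forall>e\<in>arcs G. x e \<in> {0, 1}) \<and> (\<forall>e. e \<notin> arcs G \<longrightarrow> x e = 0) \<and>
         (\<exists>p. pre_digraph.apath G s p t \<and> {e \<in> arcs G. x e = 1} = set p)}"

section \<open>The bandit game\<close>

text \<open>
  A randomized learner maps the history of the preceding rounds (own action and observed loss of each
  round, oldest first) to the distribution of its next action. Since the own past actions are part
  of the history, learners whose randomness persists between rounds (such as a random seed drawn in
  advance) are covered: conditioning on the history yields a learner of this form which induces, against
  every loss sequence, the same distribution of plays.
\<close>

type_synonym 'e history = "(('e \<Rightarrow> real) \<times> real) list"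

type_synonym 'e learner = "'e history \<Rightarrow> ('e \<Rightarrow> real) pmf"

definition plays_in :: "('e \<Rightarrow> real) set \<Rightarrow> 'e learner \<Rightarrow> bool" where
  "plays_in S A \<longleftrightarrow> (\<forall>h. set_pmf (A h) \<subseteq> S)"

text \<open>
  Distribution of the history after \<open>n\<close> rounds. Rounds are counted from 0, and only the scalar loss
  of the chosen action is revealed.
\<close>

primrec play :: "'e set \<Rightarrow> 'e learner \<Rightarrow> (nat \<Rightarrow> 'e \<Rightarrow> real) \<Rightarrow> nat \<Rightarrow> 'e history pmf" where
  "play E A l 0 = return_pmf []"
| "play E A l (Suc n) =
     bind_pmf (play E A l n) (\<lambda>h. map_pmf (\<lambda>x. h @ [(x, inner_on E (l n) x)]) (A h))"

definition expected_regret ::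
    "'e set \<Rightarrow> ('e \<Rightarrow> real) set \<Rightarrow> 'e learner \<Rightarrow> (nat \<Rightarrow> 'e \<Rightarrow> real) \<Rightarrow> nat \<Rightarrow> real" where
  "expected_regret E S A l T =
     measure_pmf.expectation (play E A l T) (\<lambda>h. \<Sum>(x, y)\<leftarrow>h. y) -
     (MIN x\<in>S. \<Sum>\<tau><T. inner_on E (l \<tau>) x)"

end

theory Submission
  imports Defs
begin

text \<open>
  Hide one good arm per layer and let the noise be common to all layers: with \<open>m\<close> layers, an action
  that hits \<open>N\<close> good arms observes \<open>m / 2 + \<epsilon> * (W - N)\<close>, where \<open>W\<close> is an integer of typical size
  \<open>1 / \<theta>\<close>. Hence the good arm of one layer merely shifts the noise by 1, and telling the \<open>n\<close> arms of a
  layer apart takes about \<open>n / \<theta>\<^sup>2\<close> rounds. With \<open>\<theta>\<close> a small multiple of \<open>sqrt (n / T)\<close> the learner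
  misses the good arms of a constant fraction of the layers, at a cost of \<open>\<epsilon>\<close> each. The noise is a
  discrete Laplace variable truncated at about \<open>ln T / \<theta>\<close>, so losses stay in the unit interval for
  \<open>\<epsilon>\<close> of order \<open>m * \<theta> / ln T\<close>, which gives regret of order \<open>m\<^sup>2 * sqrt (n * T) / ln T\<close>.

  The change of measure needs neither relative entropy nor absolute continuity: if \<open>R\<close> is the
  likelihood ratio of two environments and \<open>L\<close> a lower bound of its logarithm, then \<open>R \<ge> 1 + L\<close>, and
  \<open>L\<close> is a martingale with small second moment plus a small drift. Losses fixed in advance are obtained
  by averaging over the hidden arms and fixing the noise of one round after the other.
\<close>

section \<open>Averaging over adaptive histories\<close>

text \<open>
  Only the actions of the learner are random here; the noise enters through the weights \<open>w\<close> on the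
  finite set \<open>I\<close>, and \<open>obs x i\<close> is the feedback on action \<open>x\<close> under noise value \<open>i\<close>.
\<close>

locale noisy_game =
  fixes S :: "'x set" and A :: "('x \<times> real) list \<Rightarrow> 'x pmf"
    and I :: "int set" and w :: "int \<Rightarrow> real"
  assumes finite_actions: "finite S" and actions: "\<And>h. set_pmf (A h) \<subseteq> S"
    and w_nonneg: "\<And>i. i \<in> I \<Longrightarrow> 0 \<le> w i" and w_sum: "(\<Sum>i\<in>I. w i) = 1"
begin

definition round_avg :: "('x \<Rightarrow> int \<Rightarrow> real) \<Rightarrow> (('x \<times> real) list \<Rightarrow> real) \<Rightarrow> ('x \<times> real) list \<Rightarrow> real"
  where "round_avg obs F h =
    (\<Sum>x\<in>S. pmf (A h) x * (\<Sum>i\<in>I. w i * F (h @ [(x, obs x i)])))"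

text \<open>The expectation over \<open>n\<close> rounds as an iterated finite sum. Peeling off the
  last round first lets inductions run with the functional \<open>F\<close> generalised, and it is
  the order in which the noise is fixed later.\<close>

primrec game_avg :: "('x \<Rightarrow> int \<Rightarrow> real) \<Rightarrow> nat \<Rightarrow> (('x \<times> real) list \<Rightarrow> real) \<Rightarrow> real" where
  "game_avg obs 0 F = F []"
| "game_avg obs (Suc n) F = game_avg obs n (round_avg obs F)"

text \<open>The lists on which pointwise estimates under \<open>game_avg\<close> are required. The
  feedback entries stay free, so that one set serves every feedback map \<open>obs\<close>.\<close>

definition histories :: "nat \<Rightarrow> ('x \<times> real) list set" where
  "histories n = {h. length h = n \<and> fst ` set h \<subseteq> S}"

lemma histories_Suc: "h \<in> histories n \<Longrightarrow> x \<in> S \<Longrightarrow> h @ [(x, y)] \<in> histories (Suc n)"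
  by (auto simp: histories_def)

lemma pmf_sum_actions: "(\<Sum>x\<in>S. pmf (A h) x) = 1"
  using sum_pmf_eq_1[OF finite_actions actions] .

section \<open>Linearity and monotonicity of the averages\<close>

lemma round_avg_const: "round_avg obs (\<lambda>_. c) h = c"
  by (simp add: round_avg_def pmf_sum_actions w_sum flip: sum_distrib_right)

lemma round_avg_add: "round_avg obs (\<lambda>h. F h + G h) h = round_avg obs F h + round_avg obs G h"
  by (simp add: round_avg_def sum.distrib algebra_simps)

lemma round_avg_scale: "round_avg obs (\<lambda>h. c * F h) h = c * round_avg obs F h"
  by (simp add: round_avg_def sum_distrib_left mult_ac)

lemma game_avg_const: "game_avg obs n (\<lambda>_. c) = c"
proof (induction n)
  case (Suc n)
  have "round_avg obs (\<lambda>_. c) = (\<lambda>_. c)" by (rule ext) (rule round_avg_const)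
  with Suc show ?case by simp
qed simp

lemma game_avg_add:
  "game_avg obs n (\<lambda>h. F h + G h) = game_avg obs n F + game_avg obs n G"
proof (induction n arbitrary: F G)
  case (Suc n)
  have "round_avg obs (\<lambda>h. F h + G h) = (\<lambda>h. round_avg obs F h + round_avg obs G h)"
    by (rule ext) (rule round_avg_add)
  with Suc show ?case by simp
qed simp

lemma game_avg_scale: "game_avg obs n (\<lambda>h. c * F h) = c * game_avg obs n F"
proof (induction n arbitrary: F)
  case (Suc n)
  have "round_avg obs (\<lambda>h. c * F h) = (\<lambda>h. c * round_avg obs F h)"
    by (rule ext) (rule round_avg_scale)
  with Suc show ?case by simp
qed simp

lemma game_avg_diff:
  "game_avg obs n (\<lambda>h. F h - G h) = game_avg obs n F - game_avg obs n G"
  using game_avg_add[of obs n F "\<lambda>h. - 1 * G h"] by (simp only: game_avg_scale) simp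

lemma game_avg_sum:
  "game_avg obs n (\<lambda>h. \<Sum>j\<in>J. F j h) = (\<Sum>j\<in>J. game_avg obs n (F j))"
  by (induction J rule: infinite_finite_induct) (simp_all add: game_avg_const game_avg_add)

lemma round_avg_mono:
  assumes "\<And>h'. h' \<in> histories (Suc n) \<Longrightarrow> F h' \<le> G h'" "h \<in> histories n"
  shows "round_avg obs F h \<le> round_avg obs G h"
  unfolding round_avg_def
  by (intro sum_mono mult_left_mono assms(1) histories_Suc[OF assms(2)] w_nonneg pmf_nonneg)

lemma game_avg_mono:
  assumes "\<And>h. h \<in> histories n \<Longrightarrow> F h \<le> G h"
  shows "game_avg obs n F \<le> game_avg obs n G"
  using assms
proof (induction n arbitrary: F G)
  case (Suc n)
  have "game_avg obs n (round_avg obs F) \<le> game_avg obs n (round_avg obs G)"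
    by (rule Suc.IH, rule round_avg_mono) (use Suc.prems in auto)
  then show ?case by simp
qed (simp add: histories_def)

lemma game_avg_cong:
  assumes "\<And>x i. x \<in> S \<Longrightarrow> obs x i = obs' x i"
  shows "game_avg obs n F = game_avg obs' n F"
proof (induction n arbitrary: F)
  case (Suc n)
  have "round_avg obs F = round_avg obs' F"
    by (rule ext) (simp add: round_avg_def assms)
  with Suc show ?case by simp
qed simp

section \<open>Change of measure along a history\<close>

text \<open>Induction on the rounds: the ratios of earlier rounds factor out of the average over the
  last one, whose own ratio is absorbed by \<open>step\<close>. Since \<open>step\<close> is an
  inequality, \<open>obs'\<close> may produce feedback that \<open>obs\<close> cannot.\<close>

lemma change_of_measure:
  assumes r: "\<And>x y. 0 \<le> r x y"
    and step: "\<And>x g. x \<in> S \<Longrightarrow> (\<And>y. 0 \<le> g y) \<Longrightarrow>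
      (\<Sum>i\<in>I. w i * (g (obs x i) * r x (obs x i))) \<le> (\<Sum>i\<in>I. w i * g (obs' x i))"
    and F: "\<And>h. 0 \<le> F h"
  shows "game_avg obs n (\<lambda>h. F h * (\<Prod>(x, y)\<leftarrow>h. r x y)) \<le> game_avg obs' n F"
  using F
proof (induction n arbitrary: F)
  case (Suc n)
  let ?R = "\<lambda>h. \<Prod>(x, y)\<leftarrow>h. r x y"
  \<comment> \<open>Attaches to \<open>F\<close> the ratio of the newest round alone; rounds are
    appended, so this is the last entry.\<close>
  let ?F = "\<lambda>h. F h * (case last h of (x, y) \<Rightarrow> r x y)"
  have "round_avg obs (\<lambda>h. F h * ?R h) h = round_avg obs ?F h * ?R h" for h
    unfolding round_avg_def sum_distrib_right
    by (rule sum.cong) (simp_all add: sum_distrib_left mult_ac)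
  then have "round_avg obs (\<lambda>h. F h * ?R h) = (\<lambda>h. round_avg obs ?F h * ?R h)"
    by (rule ext)
  then have "game_avg obs (Suc n) (\<lambda>h. F h * ?R h) = game_avg obs n (\<lambda>h. round_avg obs ?F h * ?R h)"
    by simp
  also have "\<dots> \<le> game_avg obs' n (round_avg obs ?F)"
    by (rule Suc.IH) (auto simp: round_avg_def Suc.prems r w_nonneg
        intro!: sum_nonneg mult_nonneg_nonneg)
  also have "\<dots> \<le> game_avg obs' n (round_avg obs' F)"
  proof (rule game_avg_mono)
    fix h show "round_avg obs ?F h \<le> round_avg obs' F h"
      unfolding round_avg_def
    proof (rule sum_mono, rule mult_left_mono[OF _ pmf_nonneg])
      fix x assume "x \<in> S"
      from step[OF this, of "\<lambda>y. F (h @ [(x, y)])"]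
      show "(\<Sum>i\<in>I. w i * ?F (h @ [(x, obs x i)])) \<le> (\<Sum>i\<in>I. w i * F (h @ [(x, obs' x i)]))"
        by (simp add: Suc.prems)
    qed
  qed
  finally show ?case by simp
qed simp

text \<open>\<open>?D\<close> is a supermartingale: when the square is expanded after one more
  round, the cross term vanishes by \<open>mean\<close> and the new square is paid for by
  \<open>var\<close>.\<close>

lemma second_moment:
  assumes mean: "\<And>x. x \<in> S \<Longrightarrow> (\<Sum>i\<in>I. w i * \<xi> x (obs x i)) = 0"
    and var: "\<And>x. x \<in> S \<Longrightarrow> (\<Sum>i\<in>I. w i * (\<xi> x (obs x i))\<^sup>2) \<le> \<kappa> * b x"
  shows "game_avg obs n (\<lambda>h. (\<Sum>(x, y)\<leftarrow>h. \<xi> x y)\<^sup>2) \<le> \<kappa> * game_avg obs n (\<lambda>h. \<Sum>(x, y)\<leftarrow>h. b x)"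
proof -
  let ?M = "\<lambda>h. \<Sum>(x, y)\<leftarrow>h. \<xi> x y" and ?B = "\<lambda>h. \<Sum>(x, y)\<leftarrow>h. b x"
  let ?D = "\<lambda>h. (?M h)\<^sup>2 - \<kappa> * ?B h"
  have "round_avg obs ?D h \<le> ?D h" for h
  proof -
    have "(\<Sum>i\<in>I. w i * ?D (h @ [(x, obs x i)])) \<le> ?D h" if x: "x \<in> S" for x
    proof -
      have "(\<Sum>i\<in>I. w i * ?D (h @ [(x, obs x i)]))
        = (\<Sum>i\<in>I. w i * ?D h + 2 * ?M h * (w i * \<xi> x (obs x i))
            + (w i * (\<xi> x (obs x i))\<^sup>2 - w i * (\<kappa> * b x)))"
        by (rule sum.cong) (simp_all add: algebra_simps power2_eq_square)
      also have "\<dots> = (\<Sum>i\<in>I. w i) * ?D h + 2 * ?M h * (\<Sum>i\<in>I. w i * \<xi> x (obs x i))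
            + ((\<Sum>i\<in>I. w i * (\<xi> x (obs x i))\<^sup>2) - (\<Sum>i\<in>I. w i) * (\<kappa> * b x))"
        by (simp only: sum.distrib sum_subtractf flip: sum_distrib_left sum_distrib_right)
      also have "\<dots> \<le> ?D h" using var[OF x] mean[OF x] by (simp add: w_sum)
      finally show ?thesis .
    qed
    then have "round_avg obs ?D h \<le> (\<Sum>x\<in>S. pmf (A h) x * ?D h)"
      unfolding round_avg_def by (intro sum_mono mult_left_mono) auto
    also have "\<dots> = ?D h" by (simp add: pmf_sum_actions flip: sum_distrib_right)
    finally show ?thesis .
  qed
  then have "game_avg obs n ?D \<le> 0"
  proof (induction n)
    case (Suc n)
    have "game_avg obs n (round_avg obs ?D) \<le> game_avg obs n ?D"
      by (rule game_avg_mono) (rule Suc.prems)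
    with Suc show ?case by simp
  qed simp
  then show ?thesis by (simp add: game_avg_diff game_avg_scale)
qed

text \<open>On every history the likelihood ratio is at least \<open>1 - ?E h\<close>, and
  \<open>F\<close> lies between 0 and \<open>G\<close>, so reweighting costs at most
  \<open>G * ?E h\<close>. The martingale part enters \<open>?E\<close> through \<open>\<bar>M\<bar>
  \<le> \<delta> / 2 + M\<^sup>2 / (2 * \<delta>)\<close> and so costs only its second moment; the
  drift costs \<open>\<kappa> * ?B h\<close>.\<close>

lemma change_of_measure_moments:
  assumes r: "\<And>x y. 0 \<le> r x y"
    and step: "\<And>x g. x \<in> S \<Longrightarrow> (\<And>y. 0 \<le> g y) \<Longrightarrow>
      (\<Sum>i\<in>I. w i * (g (obs x i) * r x (obs x i))) \<le> (\<Sum>i\<in>I. w i * g (obs' x i))"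
    and mean: "\<And>x. x \<in> S \<Longrightarrow> (\<Sum>i\<in>I. w i * \<xi> x (obs x i)) = 0"
    and var: "\<And>x. x \<in> S \<Longrightarrow> (\<Sum>i\<in>I. w i * (\<xi> x (obs x i))\<^sup>2) \<le> \<kappa> * b x"
    and b: "\<And>x. x \<in> S \<Longrightarrow> 0 \<le> b x" and \<mu>: "\<mu> \<le> \<kappa>"
    and R: "\<And>h. h \<in> histories n \<Longrightarrow>
      1 + (\<Sum>(x, y)\<leftarrow>h. \<xi> x y - \<mu> * b x) \<le> (\<Prod>(x, y)\<leftarrow>h. r x y)"
    and F: "\<And>h. h \<in> histories n \<Longrightarrow> 0 \<le> F h \<and> F h \<le> G" and \<delta>: "0 < \<delta>" and G: "0 \<le> G"
  shows "game_avg obs' n F \<ge> game_avg obs n F -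
    G * (\<delta> / 2 + (1 / (2 * \<delta>) + 1) * \<kappa> * game_avg obs n (\<lambda>h. \<Sum>(x, y)\<leftarrow>h. b x))"
proof -
  let ?M = "\<lambda>h. \<Sum>(x, y)\<leftarrow>h. \<xi> x y" and ?B = "\<lambda>h. \<Sum>(x, y)\<leftarrow>h. b x"
  let ?E = "\<lambda>h. \<delta> / 2 + 1 / (2 * \<delta>) * (?M h)\<^sup>2 + \<kappa> * ?B h"
  \<comment> \<open>\<open>change_of_measure\<close> asks for nonnegativity on all lists, which
    \<open>F\<close> has on \<open>histories n\<close>; hence the extension by 0.\<close>
  let ?F = "\<lambda>h. if h \<in> histories n then F h else 0"
  have "F h - G * ?E h \<le> ?F h * (\<Prod>(x, y)\<leftarrow>h. r x y)" if h: "h \<in> histories n" for h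
  proof -
    have B: "0 \<le> ?B h"
      using h b by (intro sum_list_nonneg) (auto simp: histories_def)
    have "\<bar>?M h\<bar> \<le> \<delta> / 2 + 1 / (2 * \<delta>) * (?M h)\<^sup>2"
      using \<delta> zero_le_power2[of "\<bar>?M h\<bar> - \<delta>"]
      by (simp add: power2_diff field_simps power2_eq_square)
    moreover have "\<mu> * ?B h \<le> \<kappa> * ?B h" using \<mu> B by (rule mult_right_mono)
    moreover have "(\<Sum>(x, y)\<leftarrow>h. \<xi> x y - \<mu> * b x) = ?M h - \<mu> * ?B h"
      by (induction h) (auto simp: algebra_simps)
    ultimately have 1: "1 - ?E h \<le> (\<Prod>(x, y)\<leftarrow>h. r x y)"
      using R[OF h] by linarith
    have "0 \<le> \<kappa> * ?B h"
    proof -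
      have "0 \<le> \<kappa> * b x" if "x \<in> S" for x
        by (rule order_trans[OF sum_nonneg var[OF that]]) (simp add: w_nonneg)
      then have "0 \<le> (\<Sum>(x, y)\<leftarrow>h. \<kappa> * b x)"
        using h by (intro sum_list_nonneg) (auto simp: histories_def)
      also have "\<dots> = \<kappa> * ?B h" by (induction h) (auto simp: algebra_simps)
      finally show ?thesis .
    qed
    then have "0 \<le> ?E h" using \<delta> by simp
    then have "F h - G * ?E h \<le> F h - F h * ?E h"
      using F[OF h] by (simp add: mult_right_mono)
    also have "\<dots> = F h * (1 - ?E h)" by (simp add: algebra_simps)
    also have "\<dots> \<le> F h * (\<Prod>(x, y)\<leftarrow>h. r x y)"
      using 1 F[OF h] by (intro mult_left_mono) auto
    finally show ?thesis using h by simp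
  qed
  then have "game_avg obs n (\<lambda>h. F h - G * ?E h)
      \<le> game_avg obs n (\<lambda>h. ?F h * (\<Prod>(x, y)\<leftarrow>h. r x y))"
    by (rule game_avg_mono)
  also have "\<dots> \<le> game_avg obs' n ?F"
    by (rule change_of_measure) (use r step F in auto)
  also have "\<dots> \<le> game_avg obs' n F" by (rule game_avg_mono) simp
  finally have "game_avg obs n F - G * (\<delta> / 2 + 1 / (2 * \<delta>) * game_avg obs n (\<lambda>h. (?M h)\<^sup>2)
      + \<kappa> * game_avg obs n ?B) \<le> game_avg obs' n F"
    by (simp only: game_avg_diff game_avg_scale game_avg_add game_avg_const)
  moreover have "1 / (2 * \<delta>) * game_avg obs n (\<lambda>h. (?M h)\<^sup>2) \<le> 1 / (2 * \<delta>) * (\<kappa> * game_avg obs n ?B)"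
    using \<delta> by (intro mult_left_mono second_moment mean var) auto
  then have "G * (\<delta> / 2 + 1 / (2 * \<delta>) * game_avg obs n (\<lambda>h. (?M h)\<^sup>2) + \<kappa> * game_avg obs n ?B)
    \<le> G * (\<delta> / 2 + (1 / (2 * \<delta>) + 1) * \<kappa> * game_avg obs n ?B)"
    using G by (intro mult_left_mono) (auto simp: algebra_simps)
  ultimately show ?thesis by linarith
qed

end

text \<open>If every factor dominates \<open>exp (u a)\<close>, the claim is
  \<open>exp s \<ge> 1 + s\<close>. Otherwise a single very negative summand keeps the whole sum
  below -1, as the other summands add up to at most \<open>T * C\<close>, and the left side drops
  below 0.\<close>

lemma prod_list_ge_one_plus_sum_list:
  fixes r u :: "'a \<Rightarrow> real"
  assumes "\<And>a. 0 \<le> r a" and "0 \<le> C"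
    and alt: "\<And>a. u a \<le> C \<and> exp (u a) \<le> r a \<or> u a \<le> - 1 - real T * C"
    and T: "length h \<le> T"
  shows "1 + (\<Sum>a\<leftarrow>h. u a) \<le> (\<Prod>a\<leftarrow>h. r a)"
proof -
  have inv: "(\<Sum>a\<leftarrow>h. u a) \<le> real (length h) * C \<and>
    (exp (\<Sum>a\<leftarrow>h. u a) \<le> (\<Prod>a\<leftarrow>h. r a) \<or> (\<Sum>a\<leftarrow>h. u a) \<le> - 1 - real T * C + real (length h) * C)"
    for h
  proof (induction h)
    case (Cons a h)
    let ?u = "\<Sum>a\<leftarrow>h. u a" and ?r = "\<Prod>a\<leftarrow>h. r a" and ?C = "real (length h) * C"
    have "0 \<le> real T * C" using \<open>0 \<le> C\<close> by simp
    then have u: "u a \<le> C" using alt[of a] \<open>0 \<le> C\<close> by linarith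
    have len: "real (length (a # h)) * C = C + ?C" by (simp add: algebra_simps)
    have "exp (u a + ?u) \<le> r a * ?r \<or> u a + ?u \<le> - 1 - real T * C + (C + ?C)"
    proof (cases "exp (u a) \<le> r a \<and> exp ?u \<le> ?r")
      case True
      then show ?thesis using assms(1)[of a] by (simp add: exp_add mult_mono)
    next
      case False
      then show ?thesis using Cons alt[of a] u \<open>0 \<le> C\<close> by linarith
    qed
    then show ?case using Cons u by (simp add: algebra_simps)
  qed simp
  have R: "0 \<le> (\<Prod>a\<leftarrow>h. r a)" using assms(1) by (intro prod_list_nonneg) auto
  have "real (length h) * C \<le> real T * C" using T \<open>0 \<le> C\<close> by (simp add: mult_right_mono)
  then show ?thesis using inv[of h] R exp_ge_add_one_self[of "\<Sum>a\<leftarrow>h. u a"] by linarith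
qed

section \<open>Truncated discrete Laplace noise\<close>

text \<open>\<open>K\<close> enters through the normalizer: values beyond \<open>K\<close> are not
  cut off, and the truncation lies in the range of summation. The recursion in
  \<open>laplace_weight_Suc\<close> therefore holds at every integer.\<close>

definition laplace_weight :: "real \<Rightarrow> nat \<Rightarrow> int \<Rightarrow> real" where
  "laplace_weight \<theta> K i = exp (- \<theta> * \<bar>real_of_int i\<bar>) /
    (\<Sum>j\<in>{- int K..int K}. exp (- \<theta> * \<bar>real_of_int j\<bar>))"

text \<open>
  The ratio of the weights at \<open>z + 1\<close> and \<open>z\<close>, and a lower bound for its logarithm. Past the
  truncation point the ratio is 0; the value \<open>- (1 + T * \<theta>)\<close> chosen there outweighs any \<open>T - 1\<close>
  other summands, each of them at most \<open>\<theta>\<close>.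
\<close>

definition shift_ratio :: "real \<Rightarrow> nat \<Rightarrow> real \<Rightarrow> real" where
  "shift_ratio \<theta> K z = (if z \<ge> real K then 0 else if z \<ge> 0 then exp (- \<theta>) else exp \<theta>)"

definition log_shift :: "real \<Rightarrow> nat \<Rightarrow> nat \<Rightarrow> real \<Rightarrow> real" where
  "log_shift \<theta> K T z =
    (if z \<ge> real K then - (1 + real T * \<theta>) else if z \<ge> 0 then - \<theta> else \<theta>)"

lemma laplace_normalizer_ge_one:
  "1 \<le> (\<Sum>j\<in>{- int K..int K}. exp (- \<theta> * \<bar>real_of_int j\<bar>))"
  using member_le_sum[of 0 "{- int K..int K}" "\<lambda>j. exp (- \<theta> * \<bar>real_of_int j\<bar>)"] by simp

lemma laplace_weight_nonneg: "0 \<le> laplace_weight \<theta> K i"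
  unfolding laplace_weight_def by (intro divide_nonneg_nonneg sum_nonneg) auto

lemma laplace_weight_sum: "(\<Sum>i\<in>{- int K..int K}. laplace_weight \<theta> K i) = 1"
  using laplace_normalizer_ge_one[where \<theta> = \<theta> and K = K]
  by (simp add: laplace_weight_def flip: sum_divide_distrib)

lemma laplace_weight_Suc:
  "laplace_weight \<theta> K (i + 1) =
    (if i \<ge> 0 then exp (- \<theta>) else exp \<theta>) * laplace_weight \<theta> K i"
proof (cases "i \<ge> 0")
  case True
  then have "\<bar>real_of_int (i + 1)\<bar> = \<bar>real_of_int i\<bar> + 1" by simp
  with True show ?thesis by (simp add: laplace_weight_def exp_diff exp_minus field_simps)
next
  case False
  then have "\<bar>real_of_int (i + 1)\<bar> = \<bar>real_of_int i\<bar> - 1" by simp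
  with False show ?thesis by (simp add: laplace_weight_def right_diff_distrib flip: exp_add)
qed

lemma laplace_weight_edge: "laplace_weight \<theta> K (int K) \<le> exp (- \<theta> * real K)"
  unfolding laplace_weight_def
  using laplace_normalizer_ge_one[where \<theta> = \<theta> and K = K]
  by (simp add: divide_le_eq mult_le_cancel_left1)

text \<open>Already the nonnegative half of the normalizer, a geometric sum, is at least
  \<open>1 / (2 * \<theta>)\<close>.\<close>

lemma laplace_weight_zero:
  assumes "0 < \<theta>" "exp (- \<theta> * real (K + 1)) \<le> 1 / 2"
  shows "laplace_weight \<theta> K 0 \<le> 2 * \<theta>"
proof -
  let ?Z = "\<Sum>j\<in>{- int K..int K}. exp (- \<theta> * \<bar>real_of_int j\<bar>)"
  let ?q = "exp (- \<theta>)"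
  have q: "1 - ?q \<le> \<theta>" "?q < 1" using exp_ge_add_one_self[of "- \<theta>"] assms(1) by auto
  have "(1 - ?q) * (\<Sum>j<K + 1. ?q ^ j) = 1 - ?q ^ (K + 1)"
    by (rule one_diff_power_eq[symmetric])
  also have "?q ^ (K + 1) = exp (- \<theta> * real (K + 1))"
    by (subst exp_of_nat_mult[symmetric]) (simp only: mult.commute)
  finally have "1 / 2 \<le> (1 - ?q) * (\<Sum>j<K + 1. ?q ^ j)" using assms(2) by linarith
  also have "\<dots> \<le> \<theta> * (\<Sum>j<K + 1. ?q ^ j)"
    using q by (intro mult_right_mono sum_nonneg) auto
  also have "(\<Sum>j<K + 1. ?q ^ j) = (\<Sum>j\<in>{0..int K}. exp (- \<theta> * \<bar>real_of_int j\<bar>))"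
    by (rule sum.reindex_bij_witness[of _ nat int])
      (auto simp: mult.commute simp flip: exp_of_nat_mult)
  also have "\<theta> * \<dots> \<le> \<theta> * ?Z"
    using assms(1) by (intro mult_left_mono sum_mono2) auto
  finally have "1 / 2 \<le> \<theta> * ?Z" .
  then show ?thesis
    using laplace_normalizer_ge_one[where \<theta> = \<theta> and K = K]
    by (simp add: laplace_weight_def field_simps)
qed

text \<open>Re-indexing by one. The term at \<open>K\<close> drops out because its ratio is 0, and
  the extra term at \<open>- K\<close> on the right is nonnegative.\<close>

lemma laplace_shift:
  assumes "\<And>z. 0 \<le> g z"
  shows "(\<Sum>i\<in>{- int K..int K}. laplace_weight \<theta> K i * (g i * shift_ratio \<theta> K (real_of_int i)))
    \<le> (\<Sum>i\<in>{- int K..int K}. laplace_weight \<theta> K i * g (i - 1))"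
proof -
  let ?w = "laplace_weight \<theta> K"
  have "(\<Sum>i\<in>{- int K..int K}. ?w i * (g i * shift_ratio \<theta> K (real_of_int i)))
      = (\<Sum>i\<in>{- int K..int K - 1}. ?w i * (g i * shift_ratio \<theta> K (real_of_int i)))"
    by (rule sum.mono_neutral_right) (auto simp: shift_ratio_def)
  also have "\<dots> = (\<Sum>i\<in>{- int K..int K - 1}. ?w (i + 1) * g i)"
    by (rule sum.cong) (auto simp: shift_ratio_def laplace_weight_Suc)
  also have "\<dots> = (\<Sum>i\<in>{1 - int K..int K}. ?w i * g (i - 1))"
    by (rule sum.reindex_bij_witness[of _ "\<lambda>i. i - 1" "\<lambda>i. i + 1"]) auto
  also have "\<dots> \<le> (\<Sum>i\<in>{- int K..int K}. ?w i * g (i - 1))"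
    using assms by (intro sum_mono2) (auto simp: laplace_weight_nonneg)
  finally show ?thesis .
qed

lemma laplace_sgn_mean:
  "(\<Sum>i\<in>{- int K..int K}. laplace_weight \<theta> K i * sgn (real_of_int i)) = 0"
proof -
  let ?f = "\<lambda>i. laplace_weight \<theta> K i * sgn (real_of_int i)"
  have "(\<Sum>i\<in>{- int K..int K}. ?f i) = (\<Sum>i\<in>{- int K..int K}. - ?f i)"
    by (rule sum.reindex_bij_witness[of _ uminus uminus]) (auto simp: laplace_weight_def sgn_minus)
  then show ?thesis by (simp add: sum_negf)
qed

text \<open>\<open>log_shift\<close> is \<open>- \<theta> * sgn\<close> corrected at 0 and at
  \<open>K\<close>. The odd part averages to 0, so only the two corrections remain; this is why the
  drift is of second order in \<theta>.\<close>

lemma log_shift_mean: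
  assumes "0 < K"
  shows "(\<Sum>i\<in>{- int K..int K}. laplace_weight \<theta> K i * log_shift \<theta> K T (real_of_int i)) =
    - (\<theta> * laplace_weight \<theta> K 0 + (1 + real T * \<theta> - \<theta>) * laplace_weight \<theta> K (int K))"
proof -
  let ?w = "laplace_weight \<theta> K" and ?I = "{- int K..int K}"
  have "(\<Sum>i\<in>?I. ?w i * log_shift \<theta> K T (real_of_int i))
    = (\<Sum>i\<in>?I. - \<theta> * (?w i * sgn (real_of_int i)) + (if i = 0 then - \<theta> * ?w 0 else 0)
        + (if i = int K then - (1 + real T * \<theta> - \<theta>) * ?w (int K) else 0))"
    using assms by (intro sum.cong) (auto simp: log_shift_def sgn_if algebra_simps)
  also have "\<dots> = - \<theta> * (\<Sum>i\<in>?I. ?w i * sgn (real_of_int i)) - \<theta> * ?w 0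
        - (1 + real T * \<theta> - \<theta>) * ?w (int K)"
    unfolding sum.distrib sum_distrib_left[symmetric] by (simp add: left_diff_distrib)
  also have "\<dots> = - (\<theta> * ?w 0 + (1 + real T * \<theta> - \<theta>) * ?w (int K))"
    unfolding laplace_sgn_mean by (simp add: algebra_simps)
  finally show ?thesis .
qed

lemma log_shift_second_moment:
  "(\<Sum>i\<in>{- int K..int K}. laplace_weight \<theta> K i * (log_shift \<theta> K T (real_of_int i))\<^sup>2) \<le>
    \<theta>\<^sup>2 + (1 + real T * \<theta>)\<^sup>2 * laplace_weight \<theta> K (int K)"
proof -
  let ?w = "laplace_weight \<theta> K" and ?I = "{- int K..int K}"
  have "(log_shift \<theta> K T z)\<^sup>2 = (if z \<ge> real K then (1 + real T * \<theta>)\<^sup>2 else \<theta>\<^sup>2)" for z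
    by (simp add: log_shift_def power2_eq_square algebra_simps)
  then have "(\<Sum>i\<in>?I. ?w i * (log_shift \<theta> K T (real_of_int i))\<^sup>2)
    \<le> (\<Sum>i\<in>?I. \<theta>\<^sup>2 * ?w i + (if i = int K then (1 + real T * \<theta>)\<^sup>2 * ?w (int K) else 0))"
    by (intro sum_mono)
      (auto simp: laplace_weight_nonneg mult.commute)
  also have "\<dots> = \<theta>\<^sup>2 + (1 + real T * \<theta>)\<^sup>2 * ?w (int K)"
    by (simp add: sum.distrib laplace_weight_sum flip: sum_distrib_left)
  finally show ?thesis .
qed

text \<open>Centred by adding back its mean, the logarithm becomes the martingale increment.\<close>

lemma centred_log_shift:
  fixes \<theta> :: real and K T :: nat
  defines "\<mu> \<equiv> \<theta> * laplace_weight \<theta> K 0 + (1 + real T * \<theta> - \<theta>) * laplace_weight \<theta> K (int K)"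
  assumes "0 < \<theta>" "0 < K" "exp (- \<theta> * real (K + 1)) \<le> 1 / 2"
    and edge: "(1 + real T * \<theta>)\<^sup>2 * exp (- \<theta> * real K) \<le> \<theta>\<^sup>2"
  shows "(\<Sum>i\<in>{- int K..int K}. laplace_weight \<theta> K i * (log_shift \<theta> K T (real_of_int i) + \<mu>)) = 0"
    and "(\<Sum>i\<in>{- int K..int K}. laplace_weight \<theta> K i * (log_shift \<theta> K T (real_of_int i) + \<mu>)\<^sup>2)
      \<le> 3 * \<theta>\<^sup>2"
    and "\<mu> \<le> 3 * \<theta>\<^sup>2"
proof -
  let ?w = "laplace_weight \<theta> K" and ?I = "{- int K..int K}"
  let ?L = "\<lambda>i. log_shift \<theta> K T (real_of_int i)" and ?\<Lambda> = "1 + real T * \<theta>"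
  have mean: "(\<Sum>i\<in>?I. ?w i * ?L i) = - \<mu>"
    using log_shift_mean[OF \<open>0 < K\<close>] by (simp add: \<mu>_def)
  then show "(\<Sum>i\<in>?I. ?w i * (?L i + \<mu>)) = 0"
    by (simp add: distrib_left sum.distrib laplace_weight_sum flip: sum_distrib_right)
  have "1 \<le> ?\<Lambda>" using assms by simp
  have edge': "?\<Lambda>\<^sup>2 * ?w (int K) \<le> \<theta>\<^sup>2"
    using edge by (rule order_trans[OF mult_left_mono[OF laplace_weight_edge], rotated]) simp
  have "(\<Sum>i\<in>?I. ?w i * (?L i + \<mu>)\<^sup>2)
    = (\<Sum>i\<in>?I. ?w i * (?L i)\<^sup>2 + 2 * \<mu> * (?w i * ?L i) + \<mu>\<^sup>2 * ?w i)"
    by (rule sum.cong) (simp_all add: power2_sum algebra_simps)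
  also have "\<dots> = (\<Sum>i\<in>?I. ?w i * (?L i)\<^sup>2) - \<mu>\<^sup>2"
    by (simp add: sum.distrib mean laplace_weight_sum power2_eq_square flip: sum_distrib_left)
  also have "\<dots> \<le> \<theta>\<^sup>2 + ?\<Lambda>\<^sup>2 * ?w (int K)"
    using log_shift_second_moment[of \<theta> K T] zero_le_power2[of \<mu>] by linarith
  also have "\<dots> \<le> 3 * \<theta>\<^sup>2" using edge' zero_le_power2[of \<theta>] by linarith
  finally show "(\<Sum>i\<in>?I. ?w i * (?L i + \<mu>)\<^sup>2) \<le> 3 * \<theta>\<^sup>2" .
  \<comment> \<open>The centre contributes \<open>2 * \<theta>\<^sup>2\<close> to the drift and the
    truncation edge at most \<open>\<theta>\<^sup>2\<close>.\<close>
  have "\<theta> * ?w 0 \<le> \<theta> * (2 * \<theta>)"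
    using assms by (intro mult_left_mono laplace_weight_zero) auto
  moreover have "(?\<Lambda> - \<theta>) * ?w (int K) \<le> ?\<Lambda>\<^sup>2 * ?w (int K)"
    using \<open>1 \<le> ?\<Lambda>\<close> \<open>0 < \<theta>\<close> self_le_power[of ?\<Lambda> 2]
    by (intro mult_right_mono laplace_weight_nonneg) linarith
  ultimately show "\<mu> \<le> 3 * \<theta>\<^sup>2"
    using edge' by (simp add: \<mu>_def power2_eq_square)
qed

text \<open>The factor 9 makes the edge weight at most \<open>1 / T ^ 9\<close>, which beats the
  square of the penalty \<open>1 + T * \<theta>\<close>, itself at most \<open>T\<close>. Rounding
  up costs at most \<theta>, which one more \<open>ln T\<close> absorbs.\<close>

lemma noise_parameters:
  fixes n T :: nat and \<theta> :: real and K :: nat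
  defines "\<theta> \<equiv> sqrt (real n / real T) / 10" and "K \<equiv> nat \<lceil>9 * ln (real T) / \<theta>\<rceil>"
  assumes "2 \<le> n" "n \<le> T"
  shows "0 < \<theta>" "\<theta> \<le> 1 / 10" "0 < K" "exp (- \<theta> * real (K + 1)) \<le> 1 / 2"
    "(1 + real T * \<theta>)\<^sup>2 * exp (- \<theta> * real K) \<le> \<theta>\<^sup>2"
    "\<theta> * real K \<le> 10 * ln (real T)" "\<theta>\<^sup>2 = real n / (100 * real T)"
proof -
  have T: "2 \<le> real T" using assms by simp
  show \<theta>0: "0 < \<theta>" using assms by (simp add: \<theta>_def)
  show sq: "\<theta>\<^sup>2 = real n / (100 * real T)" using assms by (simp add: \<theta>_def power_divide)
  have "real n / real T \<le> 1" using assms by simp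
  then show \<theta>1: "\<theta> \<le> 1 / 10" unfolding \<theta>_def by simp
  have "1 / 2 \<le> ln (2::real)" using ln2_ge_two_thirds by simp
  also have "\<dots> \<le> ln (real T)" using T by simp
  finally have ln: "1 / 2 \<le> ln (real T)" .
  have pos: "0 < 9 * ln (real T) / \<theta>" using ln \<theta>0 by simp
  then show "0 < K" by (simp add: K_def)
  have K: "9 * ln (real T) / \<theta> \<le> real K" "real K \<le> 9 * ln (real T) / \<theta> + 1"
    using pos by (simp_all add: K_def)
  have K1: "9 * ln (real T) \<le> \<theta> * real K" using K(1) \<theta>0 by (simp add: field_simps)
  have "\<theta> * real K \<le> 9 * ln (real T) + \<theta>"
    using K(2) \<theta>0 by (simp add: field_simps)
  then show "\<theta> * real K \<le> 10 * ln (real T)" using \<theta>1 ln by linarith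
  have "exp (- \<theta> * real K) \<le> exp (- (9 * ln (real T)))" using K1 by simp
  also have "\<dots> = 1 / real T ^ 9" 
    using exp_of_nat_mult[of 9 "ln (real T)"] T by (simp add: exp_minus field_simps)
  finally have e: "exp (- \<theta> * real K) \<le> 1 / real T ^ 9" .
  have "exp (- \<theta> * real (K + 1)) \<le> exp (- \<theta> * real K)" using \<theta>0 by simp
  also have "\<dots> \<le> 1 / real T ^ 9" by (rule e)
  also have "\<dots> \<le> 1 / 2 ^ 9" using T by (intro divide_left_mono power_mono) auto
  finally show "exp (- \<theta> * real (K + 1)) \<le> 1 / 2" by simp
  have "1 + real T * \<theta> \<le> 1 + real T * (1 / 10)" using \<theta>1 by (intro add_left_mono mult_left_mono) auto
  also have "\<dots> \<le> real T" using T by simp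
  finally have "(1 + real T * \<theta>)\<^sup>2 * exp (- \<theta> * real K) \<le> (real T)\<^sup>2 * (1 / real T ^ 9)"
    using e \<theta>0 by (intro mult_mono power_mono) auto
  also have "\<dots> = 1 / (real T ^ 6 * real T)" using T by (simp add: field_simps power_numeral_reduce)
  \<comment> \<open>50 is what \<open>n \<ge> 2\<close> leaves of the 100 in
    \<open>\<theta>\<^sup>2 = n / (100 * T)\<close>.\<close>
  also have "\<dots> \<le> 1 / (50 * real T)"
  proof (intro divide_left_mono mult_right_mono)
    have "2 ^ 6 \<le> real T ^ 6" using T by (intro power_mono) auto
    then show "50 \<le> real T ^ 6" by simp
  qed (use T in auto)
  also have "\<dots> \<le> \<theta>\<^sup>2" unfolding sq using assms by (simp add: field_simps)
  finally show "(1 + real T * \<theta>)\<^sup>2 * exp (- \<theta> * real K) \<le> \<theta>\<^sup>2" .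
qed

section \<open>Confusing the arms of one layer\<close>

locale laplace_game = noisy_game S A "{- int K..int K}" "laplace_weight \<theta> K"
  for S :: "'x set" and A and K :: nat and \<theta> :: real +
  fixes T n :: nat and \<epsilon> c :: real
  assumes params: "0 < \<theta>" "0 < K" "0 < \<epsilon>" "exp (- \<theta> * real (K + 1)) \<le> 1 / 2"
    "(1 + real T * \<theta>)\<^sup>2 * exp (- \<theta> * real K) \<le> \<theta>\<^sup>2" "2 \<le> n" "\<theta>\<^sup>2 * (100 * real T) = real n"
begin

definition feedback :: "('x \<Rightarrow> real) \<Rightarrow> 'x \<Rightarrow> int \<Rightarrow> real" where
  "feedback N x i = c + \<epsilon> * (real_of_int i - N x)"

text \<open>On the actions in \<open>P\<close> the new environment is the old one with noise
  \<open>i - 1\<close> in place of \<open>i\<close>; on all others both agree. Hence only rounds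
  played in \<open>P\<close> are informative, and they are counted under the environment
  \<open>N\<close>.\<close>

lemma shift_one_action_set:
  fixes N :: "'x \<Rightarrow> real" and P :: "'x \<Rightarrow> bool"
  assumes F: "\<And>h. h \<in> histories T \<Longrightarrow> 0 \<le> F h \<and> F h \<le> G" and "0 \<le> G"
  shows "game_avg (feedback (\<lambda>x. N x + of_bool (P x))) T F \<ge> game_avg (feedback N) T F -
    G * (1 / 8 + 9 * \<theta>\<^sup>2 * game_avg (feedback N) T (\<lambda>h. \<Sum>(x, y)\<leftarrow>h. of_bool (P x)))"
proof -
  \<comment> \<open>The noise value that explains feedback \<open>y\<close> on action
    \<open>x\<close> in the environment \<open>N\<close>; ratios have to be functions of what the
    learner sees.\<close>
  let ?z = "\<lambda>x y. (y - c) / \<epsilon> + N x"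
  define \<mu> where "\<mu> = \<theta> * laplace_weight \<theta> K 0 + (1 + real T * \<theta> - \<theta>) * laplace_weight \<theta> K (int K)"
  define r where "r = (\<lambda>x y. if P x then shift_ratio \<theta> K (?z x y) else 1)"
  define \<xi> where "\<xi> = (\<lambda>x y. of_bool (P x) * (log_shift \<theta> K T (?z x y) + \<mu>))"
  note centred = centred_log_shift[OF params(1,2,4,5), folded \<mu>_def]
  have z: "?z x (feedback N x i) = real_of_int i" for x i
    using params(3) by (simp add: feedback_def)
  \<comment> \<open>Here \<open>\<delta> = 1 / 4\<close> and
    \<open>\<kappa> = 3 * \<theta>\<^sup>2\<close>, which gives the constants 1/8 and 9.\<close>
  have "game_avg (feedback (\<lambda>x. N x + of_bool (P x))) T F \<ge> game_avg (feedback N) T F -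
    G * ((1 / 4) / 2 + (1 / (2 * (1 / 4)) + 1) * (3 * \<theta>\<^sup>2) *
      game_avg (feedback N) T (\<lambda>h. \<Sum>(x, y)\<leftarrow>h. of_bool (P x)))"
  proof (rule change_of_measure_moments[where r = r and \<xi> = \<xi> and \<mu> = \<mu>])
    show "0 \<le> r x y" for x y by (simp add: r_def shift_ratio_def)
    show "(\<Sum>i\<in>{- int K..int K}. laplace_weight \<theta> K i * (g (feedback N x i) * r x (feedback N x i)))
      \<le> (\<Sum>i\<in>{- int K..int K}. laplace_weight \<theta> K i * g (feedback (\<lambda>x. N x + of_bool (P x)) x i))"
      if "\<And>y. 0 \<le> g y" for x g
    proof (cases "P x")
      case True
      have "feedback (\<lambda>x. N x + of_bool (P x)) x i = feedback N x (i - 1)" for i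
        using True by (simp add: feedback_def algebra_simps)
      with True laplace_shift[of "\<lambda>i. g (feedback N x i)" \<theta> K] that show ?thesis
        by (simp add: r_def z)
    next
      case False
      then show ?thesis by (simp add: r_def feedback_def)
    qed
    show "(\<Sum>i\<in>{- int K..int K}. laplace_weight \<theta> K i * \<xi> x (feedback N x i)) = 0" for x
      using centred(1) by (cases "P x") (simp_all add: \<xi>_def z)
    show "(\<Sum>i\<in>{- int K..int K}. laplace_weight \<theta> K i * (\<xi> x (feedback N x i))\<^sup>2)
      \<le> 3 * \<theta>\<^sup>2 * of_bool (P x)" for x
      using centred(2) by (cases "P x") (simp_all add: \<xi>_def z)
    show "\<mu> \<le> 3 * \<theta>\<^sup>2" by (rule centred(3))
    \<comment> \<open>Subtracting the drift undoes the centring: the summand is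
      \<open>log_shift\<close> on \<open>P\<close> and 0 elsewhere.\<close>
    show "1 + (\<Sum>(x, y)\<leftarrow>h. \<xi> x y - \<mu> * of_bool (P x)) \<le> (\<Prod>(x, y)\<leftarrow>h. r x y)"
      if "h \<in> histories T" for h
    proof (rule prod_list_ge_one_plus_sum_list[where C = \<theta> and T = T])
      show "0 \<le> (case a of (x, y) \<Rightarrow> r x y)" for a
        by (cases a) (simp add: r_def shift_ratio_def)
      show "(case a of (x, y) \<Rightarrow> \<xi> x y - \<mu> * of_bool (P x)) \<le> \<theta> \<and>
          exp (case a of (x, y) \<Rightarrow> \<xi> x y - \<mu> * of_bool (P x)) \<le> (case a of (x, y) \<Rightarrow> r x y)
        \<or> (case a of (x, y) \<Rightarrow> \<xi> x y - \<mu> * of_bool (P x)) \<le> - 1 - real T * \<theta>" for a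
        using params(1) by (cases a) (simp add: r_def \<xi>_def shift_ratio_def log_shift_def)
    qed (use that params(1) in \<open>auto simp: histories_def\<close>)
  qed (use assms in auto)
  then show ?thesis by simp
qed

text \<open>All \<open>n\<close> environments are compared with the one in which no arm of the layer
  is favoured. There the arms share \<open>T\<close> rounds, so the sum of the \<open>?V j\<close>
  is at most \<open>T\<close>, and a typical arm is played too rarely to be recognised.\<close>

lemma arms_confused:
  fixes N :: "'x \<Rightarrow> real" and P :: "nat \<Rightarrow> 'x \<Rightarrow> bool"
  assumes P: "\<And>x. x \<in> S \<Longrightarrow> (\<Sum>j<n. of_bool (P j x)) \<le> (1::real)"
  shows "(\<Sum>j<n. game_avg (feedback (\<lambda>x. N x + of_bool (P j x))) T
    (\<lambda>h. \<Sum>(x, y)\<leftarrow>h. 1 - of_bool (P j x))) \<ge> real n * real T / 4"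
proof -
  let ?B = "\<lambda>j h. \<Sum>(x, y)\<leftarrow>h. of_bool (P j x) :: real"
  let ?F = "\<lambda>j h. \<Sum>(x, y)\<leftarrow>h. 1 - of_bool (P j x) :: real"
  let ?V = "\<lambda>j. game_avg (feedback N) T (?B j)"
  have F: "?F j h = real (length h) - ?B j h" for j h
    by (induction h) auto
  have B: "0 \<le> ?B j h" "?B j h \<le> real (length h)" for j h
    by (induction h) auto
  have avg: "game_avg obs T (?F j) = real T - game_avg obs T (?B j)" for obs j
  proof -
    have "game_avg obs T (?F j) \<le> game_avg obs T (\<lambda>h. real T - ?B j h)"
      by (rule game_avg_mono) (simp add: F histories_def)
    moreover have "game_avg obs T (\<lambda>h. real T - ?B j h) \<le> game_avg obs T (?F j)"
      by (rule game_avg_mono) (simp add: F histories_def)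
    ultimately show ?thesis by (simp add: game_avg_diff game_avg_const)
  qed
  have "(\<Sum>j<n. ?V j) = game_avg (feedback N) T (\<lambda>h. \<Sum>j<n. ?B j h)"
    by (simp add: game_avg_sum)
  also have "\<dots> \<le> game_avg (feedback N) T (\<lambda>_. real T)"
  proof (rule game_avg_mono)
    have "(\<Sum>j<n. ?B j h) \<le> real (length h)" if "fst ` set h \<subseteq> S" for h
      using that
    proof (induction h)
      case (Cons p h)
      have "(\<Sum>j<n. ?B j (p # h)) = (\<Sum>j<n. of_bool (P j (fst p))) + (\<Sum>j<n. ?B j h)"
        by (simp add: sum.distrib case_prod_beta)
      also have "\<dots> \<le> 1 + real (length h)"
        using Cons by (intro add_mono P) auto
      finally show ?case by simp
    qed simp
    then show "(\<Sum>j<n. ?B j h) \<le> real T" if "h \<in> histories T" for h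
      using that by (auto simp: histories_def)
  qed
  finally have V: "(\<Sum>j<n. ?V j) \<le> real T" by (simp add: game_avg_const)
  have "(\<Sum>j<n. real T - ?V j - real T * (1 / 8 + 9 * \<theta>\<^sup>2 * ?V j))
    \<le> (\<Sum>j<n. game_avg (feedback (\<lambda>x. N x + of_bool (P j x))) T (?F j))"
  proof (rule sum_mono)
    fix j
    have "0 \<le> ?F j h \<and> ?F j h \<le> real T" if "h \<in> histories T" for h
      using that B(1)[of j h] B(2)[of j h] unfolding F by (simp add: histories_def)
    then have "game_avg (feedback (\<lambda>x. N x + of_bool (P j x))) T (?F j)
      \<ge> game_avg (feedback N) T (?F j) - real T * (1 / 8 + 9 * \<theta>\<^sup>2 * ?V j)"
      by (intro shift_one_action_set) auto
    then show "real T - ?V j - real T * (1 / 8 + 9 * \<theta>\<^sup>2 * ?V j)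
      \<le> game_avg (feedback (\<lambda>x. N x + of_bool (P j x))) T (?F j)"
      by (simp only: avg)
  qed
  moreover have "(\<Sum>j<n. real T - ?V j - real T * (1 / 8 + 9 * \<theta>\<^sup>2 * ?V j))
    = 7 / 8 * real n * real T - (1 + 9 * \<theta>\<^sup>2 * real T) * (\<Sum>j<n. ?V j)"
    by (simp add: sum.distrib sum_subtractf sum_distrib_left algebra_simps)
  moreover have "(1 + 9 * \<theta>\<^sup>2 * real T) * (\<Sum>j<n. ?V j) \<le> (1 + 9 * \<theta>\<^sup>2 * real T) * real T"
    using V by (intro mult_left_mono) auto
  \<comment> \<open>Uses \<open>1 \<le> n / 2\<close> and
    \<open>9 * \<theta>\<^sup>2 * T = 9 * n / 100\<close>; the remaining fraction 7/8 - 1/2 - 9/100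
    exceeds 1/4.\<close>
  moreover have "(1 + 9 * \<theta>\<^sup>2 * real T) * real T \<le> (real n / 2 + 9 * real n / 100) * real T"
    using params(6,7) by (intro mult_right_mono) auto
  moreover have "7 / 8 * real n * real T - (real n / 2 + 9 * real n / 100) * real T \<ge> real n * real T / 4"
    by (simp add: field_simps)
  ultimately show ?thesis by linarith
qed

end

section \<open>Fixing the noise in advance\<close>

lemma play_cong:
  assumes "\<And>\<tau>. \<tau> < n \<Longrightarrow> l \<tau> = l' \<tau>"
  shows "play E A l n = play E A l' n"
  using assms by (induction n) simp_all

lemma finite_set_play:
  assumes "finite S" "plays_in S A"
  shows "finite (set_pmf (play E A l n))"
proof (induction n)
  case (Suc n)
  have "finite (set_pmf (A h))" for h
    using assms finite_subset unfolding plays_in_def by blast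
  with Suc show ?case by simp
qed simp

lemma expectation_play_Suc:
  assumes "finite S" "plays_in S A"
  shows "measure_pmf.expectation (play E A l (Suc n)) F =
    measure_pmf.expectation (play E A l n)
      (\<lambda>h. \<Sum>x\<in>S. pmf (A h) x * F (h @ [(x, inner_on E (l n) x)]))"
proof -
  let ?p = "play E A l n"
  let ?Q = "\<lambda>h. map_pmf (\<lambda>x. h @ [(x, inner_on E (l n) x)]) (A h)"
  have supp: "set_pmf (A h) \<subseteq> S" for h using assms(2) by (simp add: plays_in_def)
  have fin: "finite (set_pmf ?p)" by (rule finite_set_play[OF assms])
  have inner: "measure_pmf.expectation (?Q h) F
    = (\<Sum>x\<in>S. pmf (A h) x * F (h @ [(x, inner_on E (l n) x)]))" for h
    using supp[of h] assms(1)
    by (simp add: integral_map_pmf, subst integral_measure_pmf_real[where A = S])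
      (auto simp: mult.commute)
  have "measure_pmf.expectation (play E A l (Suc n)) F
    = (\<Sum>h\<in>set_pmf ?p. pmf ?p h *\<^sub>R measure_pmf.expectation (?Q h) F)"
    unfolding play.simps
    by (rule pmf_expectation_bind[OF fin]) (use supp assms(1) in \<open>auto intro: finite_subset\<close>)
  also have "\<dots> = measure_pmf.expectation ?p (\<lambda>h. measure_pmf.expectation (?Q h) F)"
    by (rule integral_measure_pmf[OF fin, symmetric]) auto
  finally show ?thesis by (simp only: inner)
qed

lemma weighted_mean_le:
  fixes w g :: "'a \<Rightarrow> real"
  assumes "finite I" "\<And>i. i \<in> I \<Longrightarrow> 0 \<le> w i" "(\<Sum>i\<in>I. w i) = 1"
  shows "\<exists>i\<in>I. (\<Sum>i\<in>I. w i * g i) \<le> g i"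
proof -
  have ne: "I \<noteq> {}" using assms(3) by auto
  have "(\<Sum>i\<in>I. w i * g i) \<le> (\<Sum>i\<in>I. w i * Max (g ` I))"
    using assms by (intro sum_mono mult_left_mono) auto
  also have "\<dots> = Max (g ` I)" by (simp add: assms(3) flip: sum_distrib_right)
  finally have "(\<Sum>i\<in>I. w i * g i) \<le> Max (g ` I)" .
  moreover obtain i where "i \<in> I" "g i = Max (g ` I)"
    using Max_in[of "g ` I"] ne assms(1) by fastforce
  ultimately show ?thesis by (intro bexI[of _ i]) simp_all
qed

text \<open>
  The noise values are chosen from the last round backwards: an arbitrary functional of the history
  turns into one of the shorter history when the last round is averaged over the actions.
\<close>

lemma fix_noise:
  fixes loss :: "int \<Rightarrow> 'e \<Rightarrow> real"
  assumes "noisy_game S A I w" "plays_in S A"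
  shows "\<exists>v. (\<forall>\<tau>. v \<tau> \<in> I) \<and>
    noisy_game.game_avg S A I w (\<lambda>x i. inner_on E (loss i) x) n F
      \<le> measure_pmf.expectation (play E A (\<lambda>\<tau>. loss (v \<tau>)) n) F"
proof (induction n arbitrary: F)
  interpret noisy_game S A I w by (rule assms(1))
  case 0
  have "I \<noteq> {}" using w_sum by auto
  then show ?case by auto
next
  interpret noisy_game S A I w by (rule assms(1))
  let ?obs = "\<lambda>x i. inner_on E (loss i) x"
  case (Suc n)
  define G where "G = (\<lambda>i h. \<Sum>x\<in>S. pmf (A h) x * F (h @ [(x, ?obs x i)]))"
  have "round_avg ?obs F = (\<lambda>h. \<Sum>i\<in>I. w i * G i h)"
    unfolding round_avg_def G_def sum_distrib_left
    by (rule ext, subst sum.swap) (simp add: mult_ac)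
  then have avg: "game_avg ?obs (Suc n) F = (\<Sum>i\<in>I. w i * game_avg ?obs n (G i))"
    by (simp add: game_avg_sum game_avg_scale)
  have "finite I" using w_sum by (metis sum.infinite zero_neq_one)
  then obtain i where i: "i \<in> I" "game_avg ?obs (Suc n) F \<le> game_avg ?obs n (G i)"
    using weighted_mean_le[of I w "\<lambda>i. game_avg ?obs n (G i)"] w_nonneg w_sum avg by auto
  obtain v where v: "\<forall>\<tau>. v \<tau> \<in> I"
    "game_avg ?obs n (G i) \<le> measure_pmf.expectation (play E A (\<lambda>\<tau>. loss (v \<tau>)) n) (G i)"
    using Suc[of "G i"] by auto
  \<comment> \<open>Rounds are counted from 0: the round just averaged has index \<open>n\<close>,
    and the first \<open>n\<close> rounds keep their noise.\<close>
  let ?v = "v(n := i)"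
  have "play E A (\<lambda>\<tau>. loss (?v \<tau>)) n = play E A (\<lambda>\<tau>. loss (v \<tau>)) n"
    by (rule play_cong) auto
  then have "measure_pmf.expectation (play E A (\<lambda>\<tau>. loss (?v \<tau>)) (Suc n)) F
    = measure_pmf.expectation (play E A (\<lambda>\<tau>. loss (v \<tau>)) n) (G i)"
    unfolding expectation_play_Suc[OF finite_actions assms(2)] G_def by simp
  with i v show ?case by (intro exI[of _ ?v]) auto
qed

section \<open>The lower bound for layered action sets\<close>

text \<open>Exchanging \<open>f i\<close> with \<open>j\<close> is an involution on the pairs
  \<open>(f, j)\<close>: resampling one coordinate preserves the uniform distribution.\<close>

lemma sum_PiE_resample:
  fixes g :: "('i \<Rightarrow> 'j) \<Rightarrow> real"
  assumes "i \<in> I"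
  shows "(\<Sum>f\<in>I \<rightarrow>\<^sub>E J. \<Sum>j\<in>J. g (f(i := j))) = real (card J) * (\<Sum>f\<in>I \<rightarrow>\<^sub>E J. g f)"
proof -
  have "(\<Sum>f\<in>I \<rightarrow>\<^sub>E J. \<Sum>j\<in>J. g (f(i := j))) = (\<Sum>(f, j)\<in>(I \<rightarrow>\<^sub>E J) \<times> J. g (f(i := j)))"
    by (rule sum.cartesian_product)
  also have "\<dots> = (\<Sum>(f, j)\<in>(I \<rightarrow>\<^sub>E J) \<times> J. g f)"
    by (rule sum.reindex_bij_witness[of _ "\<lambda>(f, j). (f(i := j), f i)" "\<lambda>(f, j). (f(i := j), f i)"])
      (use assms in \<open>auto simp: PiE_iff extensional_def\<close>)
  also have "\<dots> = (\<Sum>f\<in>I \<rightarrow>\<^sub>E J. \<Sum>j\<in>J. g f)"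
    by (rule sum.cartesian_product[symmetric])
  finally show ?thesis by (simp add: sum_distrib_left)
qed

text \<open>
  \<open>B i\<close> are the arcs of which every action uses exactly one, and \<open>a i j\<close> (for \<open>j < n\<close>) the arcs of
  \<open>B i\<close> that may be favoured.
\<close>

locale layered_actions =
  fixes E :: "'e set" and S :: "('e \<Rightarrow> real) set" and m n :: nat
    and B :: "nat \<Rightarrow> 'e set" and a :: "nat \<Rightarrow> nat \<Rightarrow> 'e"
  assumes finite_E: "finite E" and finite_S: "finite S"
    and zero_one: "\<And>x e. x \<in> S \<Longrightarrow> e \<in> E \<Longrightarrow> x e \<in> {0, 1}"
    and B_sub: "\<And>i. i < m \<Longrightarrow> B i \<subseteq> E"
    and B_disj: "\<And>i i' e. i < m \<Longrightarrow> i' < m \<Longrightarrow> e \<in> B i \<Longrightarrow> e \<in> B i' \<Longrightarrow> i = i'"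
    and one: "\<And>x i. x \<in> S \<Longrightarrow> i < m \<Longrightarrow> (\<Sum>e\<in>B i. x e) = 1"
    and a_in: "\<And>i j. i < m \<Longrightarrow> j < n \<Longrightarrow> a i j \<in> B i"
    and a_inj: "\<And>i. i < m \<Longrightarrow> inj_on (a i) {..<n}"
    and choice: "\<And>f. (\<And>i. i < m \<Longrightarrow> f i < n) \<Longrightarrow> \<exists>x\<in>S. \<forall>i<m. x (a i (f i)) = 1"
    and m_pos: "0 < m" and n_ge: "2 \<le> n"
begin

definition hit :: "(nat \<Rightarrow> nat) \<Rightarrow> nat \<Rightarrow> ('e \<Rightarrow> real) \<Rightarrow> bool" where
  "hit f i x \<longleftrightarrow> x (a i (f i)) = 1"

text \<open>The noise is divided by \<open>m\<close> because every action collects it once per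
  layer. Arcs outside all \<open>B i\<close> get loss 0.\<close>

definition layer_loss :: "real \<Rightarrow> (nat \<Rightarrow> nat) \<Rightarrow> int \<Rightarrow> 'e \<Rightarrow> real" where
  "layer_loss \<epsilon> f v e = (\<Sum>i<m. if e \<in> B i
     then 1 / 2 + \<epsilon> / real m * real_of_int v - (if e = a i (f i) then \<epsilon> else 0) else 0)"

lemma inner_layer_loss:
  assumes x: "x \<in> S" and f: "\<And>i. i < m \<Longrightarrow> f i < n"
  shows "inner_on E (layer_loss \<epsilon> f v) x =
    real m / 2 + \<epsilon> * (real_of_int v - (\<Sum>i<m. of_bool (hit f i x)))"
proof -
  let ?u = "1 / 2 + \<epsilon> / real m * real_of_int v"
  have "inner_on E (layer_loss \<epsilon> f v) x = (\<Sum>e\<in>E. \<Sum>i<m. if e \<in> B i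
     then (?u - (if e = a i (f i) then \<epsilon> else 0)) * x e else 0)"
    unfolding inner_on_def layer_loss_def sum_distrib_right by (intro sum.cong) auto
  also have "\<dots> = (\<Sum>i<m. \<Sum>e\<in>E. if e \<in> B i
     then (?u - (if e = a i (f i) then \<epsilon> else 0)) * x e else 0)"
    by (rule sum.swap)
  also have "\<dots> = (\<Sum>i<m. ?u - \<epsilon> * of_bool (hit f i x))"
  proof (rule sum.cong)
    fix i assume "i \<in> {..<m}"
    then have i: "i < m" by simp
    have finB: "finite (B i)" using B_sub[OF i] finite_E finite_subset by blast
    have "(\<Sum>e\<in>E. if e \<in> B i then (?u - (if e = a i (f i) then \<epsilon> else 0)) * x e else 0)
      = (\<Sum>e\<in>B i. (?u - (if e = a i (f i) then \<epsilon> else 0)) * x e)"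
      using finite_E B_sub[OF i] by (simp add: sum.inter_restrict[symmetric] Int_absorb1)
    also have "\<dots> = (\<Sum>e\<in>B i. ?u * x e - (if e = a i (f i) then \<epsilon> * x (a i (f i)) else 0))"
      by (rule sum.cong) (auto simp: algebra_simps)
    also have "\<dots> = ?u * (\<Sum>e\<in>B i. x e) - \<epsilon> * x (a i (f i))"
      using a_in[OF i f[OF i]] finB by (simp add: sum_subtractf sum_distrib_left)
    also have "\<dots> = ?u - \<epsilon> * of_bool (hit f i x)"
      using one[OF x i] zero_one[OF x, of "a i (f i)"] a_in[OF i f[OF i]] B_sub[OF i]
      by (auto simp: hit_def)
    finally show "(\<Sum>e\<in>E. if e \<in> B i then (?u - (if e = a i (f i) then \<epsilon> else 0)) * x e else 0)
      = ?u - \<epsilon> * of_bool (hit f i x)" .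
  qed simp
  also have "\<dots> = real m / 2 + \<epsilon> * (real_of_int v - (\<Sum>i<m. of_bool (hit f i x)))"
    using m_pos by (simp only: sum_subtractf flip: sum_distrib_left) (simp add: field_simps)
  finally show ?thesis .
qed

text \<open>By disjointness at most one summand is active, and it lies between 1/2 - 1/4 - 1/4 and
  1/2 + 1/4.\<close>

lemma layer_loss_bounds:
  assumes "\<bar>\<epsilon> / real m * real_of_int v\<bar> \<le> 1 / 4" "0 \<le> \<epsilon>" "\<epsilon> \<le> 1 / 4"
  shows "layer_loss \<epsilon> f v e \<in> {0..1}"
proof (cases "\<exists>i<m. e \<in> B i")
  case True
  then obtain i where i: "i < m" "e \<in> B i" by auto
  then have "e \<in> B i' \<longleftrightarrow> i' = i" if "i' < m" for i'
    using that B_disj by auto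
  then have "layer_loss \<epsilon> f v e = (\<Sum>i'<m. if i' = i
    then 1 / 2 + \<epsilon> / real m * real_of_int v - (if e = a i (f i) then \<epsilon> else 0) else 0)"
    unfolding layer_loss_def by (intro sum.cong) auto
  also have "\<dots> = 1 / 2 + \<epsilon> / real m * real_of_int v - (if e = a i (f i) then \<epsilon> else 0)"
    using i by simp
  finally have "layer_loss \<epsilon> f v e = \<dots>" .
  moreover have "- (1 / 4) \<le> \<epsilon> / real m * real_of_int v" "\<epsilon> / real m * real_of_int v \<le> 1 / 4"
    using assms(1) by linarith+
  moreover have "0 \<le> 1 / 2 + t - (if b then \<epsilon> else 0) \<and> 1 / 2 + t - (if b then \<epsilon> else 0) \<le> 1"
    if "- (1 / 4) \<le> t" "t \<le> 1 / 4" for t b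
    using that assms(2,3) by (cases b) auto
  ultimately show ?thesis by (simp only: atLeastAtMost_iff)
next
  case False
  then show ?thesis by (simp add: layer_loss_def)
qed

text \<open>The noise is common to all actions and cancels against a comparator that hits every
  favoured arc; what is left is \<epsilon> per missed layer and round.\<close>

lemma regret_ge_misses:
  assumes A: "plays_in S A" and f: "\<And>i. i < m \<Longrightarrow> f i < n"
  shows "expected_regret E S A (\<lambda>\<tau>. layer_loss \<epsilon> f (v \<tau>)) T \<ge>
    \<epsilon> * measure_pmf.expectation (play E A (\<lambda>\<tau>. layer_loss \<epsilon> f (v \<tau>)) T)
      (\<lambda>h. \<Sum>(x, y)\<leftarrow>h. \<Sum>i<m. 1 - of_bool (hit f i x))"
proof -
  let ?l = "\<lambda>\<tau>. layer_loss \<epsilon> f (v \<tau>)"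
  let ?p = "play E A ?l"
  let ?W = "\<lambda>\<tau>. real m / 2 + \<epsilon> * (real_of_int (v \<tau>) - real m)"
  let ?M = "\<lambda>h::'e history. \<Sum>(x, y)\<leftarrow>h. \<Sum>i<m. 1 - of_bool (hit f i x) :: real"
  have loss: "inner_on E (?l \<tau>) x = \<epsilon> * (\<Sum>i<m. 1 - of_bool (hit f i x)) + ?W \<tau>"
    if "x \<in> S" for x \<tau>
  proof -
    have "inner_on E (?l \<tau>) x = real m / 2 + \<epsilon> * (real_of_int (v \<tau>) - (\<Sum>i<m. of_bool (hit f i x)))"
      by (rule inner_layer_loss) (use that f in auto)
    then show ?thesis by (simp only: sum_subtractf) (simp add: algebra_simps)
  qed
  have total: "(\<Sum>(x, y)\<leftarrow>h. y) = \<epsilon> * ?M h + (\<Sum>\<tau><t. ?W \<tau>)" if "h \<in> set_pmf (?p t)" for h t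
    using that
  proof (induction t arbitrary: h)
    case (Suc t)
    then obtain h' x where h: "h' \<in> set_pmf (?p t)" "x \<in> set_pmf (A h')"
      "h = h' @ [(x, inner_on E (?l t) x)]"
      by auto
    then have "x \<in> S" using A by (auto simp: plays_in_def)
    have "(\<Sum>(x, y)\<leftarrow>h. y) = (\<Sum>(x, y)\<leftarrow>h'. y) + inner_on E (?l t) x" by (simp add: h(3))
    also have "\<dots> = \<epsilon> * (?M h' + (\<Sum>i<m. 1 - of_bool (hit f i x))) + (\<Sum>\<tau><Suc t. ?W \<tau>)"
      unfolding Suc.IH[OF h(1)] loss[OF \<open>x \<in> S\<close>] sum.lessThan_Suc by (simp only: algebra_simps)
    also have "?M h' + (\<Sum>i<m. 1 - of_bool (hit f i x)) = ?M h" by (simp add: h(3))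
    finally show ?case .
  qed simp
  have fin: "finite (set_pmf (?p T))" by (rule finite_set_play[OF finite_S A])
  have "measure_pmf.expectation (?p T) (\<lambda>h. \<Sum>(x, y)\<leftarrow>h. y)
    = measure_pmf.expectation (?p T) (\<lambda>h. \<epsilon> * ?M h + (\<Sum>\<tau><T. ?W \<tau>))"
    by (intro integral_cong_AE) (auto simp: AE_measure_pmf_iff total)
  also have "\<dots> = \<epsilon> * measure_pmf.expectation (?p T) ?M + (\<Sum>\<tau><T. ?W \<tau>)"
    using fin by (subst Bochner_Integration.integral_add)
      (auto intro: integrable_measure_pmf_finite)
  finally have exp: "measure_pmf.expectation (?p T) (\<lambda>h. \<Sum>(x, y)\<leftarrow>h. y)
    = \<epsilon> * measure_pmf.expectation (?p T) ?M + (\<Sum>\<tau><T. ?W \<tau>)" .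
  obtain x where x: "x \<in> S" "\<forall>i<m. x (a i (f i)) = 1" using choice[of f] f by auto
  have "(MIN x\<in>S. \<Sum>\<tau><T. inner_on E (?l \<tau>) x) \<le> (\<Sum>\<tau><T. inner_on E (?l \<tau>) x)"
    using finite_S x(1) by (intro Min_le) auto
  also have "\<dots> = (\<Sum>\<tau><T. ?W \<tau>)"
    using x by (intro sum.cong) (auto simp: loss hit_def)
  finally show ?thesis unfolding expected_regret_def exp by linarith
qed

text \<open>With the favoured arcs of the other layers held fixed, \<open>arms_confused\<close>
  applies to one layer. Averaging over all \<open>f\<close> treats every layer alike, so some
  \<open>f\<close> makes the learner miss at least a quarter of all pairs of a layer and a round on
  average over the noise.\<close>

lemma regret_lower_bound:
  assumes A: "plays_in S A" and T: "m\<^sup>2 * n \<le> T"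
  shows "\<exists>l. (\<forall>\<tau>. \<forall>e\<in>E. l \<tau> e \<in> {0..1}) \<and>
    (real m)\<^sup>2 * sqrt (real n * real T) / (1600 * ln (real T)) \<le> expected_regret E S A l T"
proof -
  have "1 * n \<le> m\<^sup>2 * n" using m_pos by (intro mult_right_mono) auto
  then have nT: "n \<le> T" using T by linarith
  then have T2: "2 \<le> T" using n_ge by simp
  define \<theta> where "\<theta> = sqrt (real n / real T) / 10"
  define K where "K = nat \<lceil>9 * ln (real T) / \<theta>\<rceil>"
  \<comment> \<open>As \<open>\<theta> * K \<le> 10 * ln T\<close>, the noise on a single arc, at
    most \<open>\<epsilon> * K / m\<close>, stays within 1/4.\<close>
  define \<epsilon> where "\<epsilon> = real m * \<theta> / (40 * ln (real T))"
  note par = noise_parameters[OF n_ge nT, folded \<theta>_def, folded K_def]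
  have "1 / 2 \<le> ln (2::real)" using ln2_ge_two_thirds by simp
  also have "\<dots> \<le> ln (real T)" using T2 by simp
  finally have ln: "1 / 2 \<le> ln (real T)" .
  have \<epsilon>0: "0 < \<epsilon>" using par(1) ln m_pos by (simp add: \<epsilon>_def)
  \<comment> \<open>The condition on the horizon enters here: it bounds \<open>m * \<theta>\<close>,
    and thereby \<epsilon>.\<close>
  have "(real m * \<theta>)\<^sup>2 = real (m\<^sup>2 * n) / (100 * real T)" using par(7) by (simp add: power_mult_distrib)
  also have "\<dots> \<le> real T / (100 * real T)" 
    using T of_nat_le_iff[of "m\<^sup>2 * n" T, where 'a = real]
    by (intro divide_right_mono) (blast, simp)
  also have "\<dots> \<le> 1\<^sup>2" using T2 by simp
  finally have m\<theta>: "real m * \<theta> \<le> 1" by (rule power2_le_imp_le) simp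
  then have "real m * \<theta> * 4 \<le> 40 * ln (real T)" using ln by linarith
  then have \<epsilon>1: "\<epsilon> \<le> 1 / 4" using ln by (simp add: \<epsilon>_def field_simps)
  let ?w = "laplace_weight \<theta> K" and ?I = "{- int K..int K}"
  interpret laplace_game S A K \<theta> T n \<epsilon> "real m / 2"
    using finite_S A n_ge par \<epsilon>0 T2
    by unfold_locales (auto simp: plays_in_def laplace_weight_nonneg laplace_weight_sum)
  let ?N = "\<lambda>f x. \<Sum>i<m. of_bool (hit f i x) :: real"
  let ?\<Phi> = "\<lambda>f i. game_avg (feedback (?N f)) T (\<lambda>h. \<Sum>(x, y)\<leftarrow>h. 1 - of_bool (hit f i x))"
  let ?D = "{..<m} \<rightarrow>\<^sub>E {..<n}"
  have layer: "real (card ?D) * (real T / 4) \<le> (\<Sum>f\<in>?D. ?\<Phi> f i)" if i: "i < m" for i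
  proof -
    have "real n * real T / 4 \<le> (\<Sum>j<n. ?\<Phi> (f(i := j)) i)" for f
    proof -
      \<comment> \<open>Hits outside layer \<open>i\<close>: the reference environment for
        \<open>arms_confused\<close>, in which layer \<open>i\<close> has no favoured arc.\<close>
      let ?R = "\<lambda>x. \<Sum>i'\<in>{..<m} - {i}. of_bool (hit f i' x) :: real"
      have "?N (f(i := j)) = (\<lambda>x. ?R x + of_bool (x (a i j) = 1))" for j
      proof
        fix x
        have "?N (f(i := j)) x = of_bool (x (a i j) = 1)
            + (\<Sum>i'\<in>{..<m} - {i}. of_bool (hit (f(i := j)) i' x))"
          using i by (subst sum.remove[of _ i]) (auto simp: hit_def)
        also have "(\<Sum>i'\<in>{..<m} - {i}. of_bool (hit (f(i := j)) i' x)) = ?R x"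
          by (rule sum.cong) (auto simp: hit_def)
        finally show "?N (f(i := j)) x = ?R x + of_bool (x (a i j) = 1)"
          by (simp only: add.commute)
      qed
      moreover have "real n * real T / 4 \<le> (\<Sum>j<n. game_avg (feedback (\<lambda>x. ?R x + of_bool (x (a i j) = 1))) T
        (\<lambda>h. \<Sum>(x, y)\<leftarrow>h. 1 - of_bool (x (a i j) = 1)))"
      proof (rule arms_confused)
        fix x assume x: "x \<in> S"
        have x01: "0 \<le> x e" if "e \<in> B i" for e
          using zero_one[OF x subsetD[OF B_sub[OF i] that]] by auto
        have "(\<Sum>j<n. of_bool (x (a i j) = 1)) \<le> (\<Sum>j<n. x (a i j))"
          using x01[OF a_in[OF i]] by (intro sum_mono) auto
        also have "\<dots> = (\<Sum>e\<in>a i ` {..<n}. x e)"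
          using a_inj[OF i] by (simp add: sum.reindex)
        also have "\<dots> \<le> (\<Sum>e\<in>B i. x e)"
          using x01 a_in[OF i] finite_subset[OF B_sub[OF i] finite_E] by (intro sum_mono2) auto
        finally show "(\<Sum>j<n. of_bool (x (a i j) = 1)) \<le> (1::real)" using one[OF x i] by simp
      qed
      ultimately show ?thesis by (simp add: hit_def)
    qed
    then have "(\<Sum>f\<in>?D. real n * real T / 4) \<le> (\<Sum>f\<in>?D. \<Sum>j<n. ?\<Phi> (f(i := j)) i)"
      by (intro sum_mono)
    also have "\<dots> = real (card {..<n}) * (\<Sum>f\<in>?D. ?\<Phi> f i)"
      by (rule sum_PiE_resample) (use i in simp)
    finally show ?thesis using n_ge by (simp add: field_simps)
  qed
  have "\<exists>f\<in>?D. real m * real T / 4 \<le> (\<Sum>i<m. ?\<Phi> f i)"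
  proof (rule ccontr)
    assume "\<not> ?thesis"
    then have "(\<Sum>f\<in>?D. \<Sum>i<m. ?\<Phi> f i) < (\<Sum>f\<in>?D. real m * real T / 4)"
      using n_ge by (intro sum_strict_mono finite_PiE) (auto simp: PiE_eq_empty_iff lessThan_empty_iff not_le)
    moreover have "(\<Sum>i<m. real (card ?D) * (real T / 4)) \<le> (\<Sum>i<m. \<Sum>f\<in>?D. ?\<Phi> f i)"
      by (intro sum_mono layer) simp
    moreover have "(\<Sum>i<m. \<Sum>f\<in>?D. ?\<Phi> f i) = (\<Sum>f\<in>?D. \<Sum>i<m. ?\<Phi> f i)"
      by (rule sum.swap)
    moreover have "(\<Sum>i<m. real (card ?D) * (real T / 4)) = (\<Sum>f\<in>?D. real m * real T / 4)"
      by simp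
    ultimately show False by (simp only: less_le_not_le)
  qed
  then obtain f where f: "f \<in> ?D" and \<Phi>: "real m * real T / 4 \<le> (\<Sum>i<m. ?\<Phi> f i)" by auto
  have fn: "f i < n" if "i < m" for i using f that by auto
  let ?M = "\<lambda>h::'e history. \<Sum>(x, y)\<leftarrow>h. \<Sum>i<m. 1 - of_bool (hit f i x) :: real"
  have "?M h = (\<Sum>i<m. \<Sum>(x, y)\<leftarrow>h. 1 - of_bool (hit f i x))" for h
    by (induction h) (auto simp: sum.distrib)
  then have "real m * real T / 4 \<le> game_avg (feedback (?N f)) T ?M"
    using \<Phi> by (simp add: game_avg_sum)
  also have "game_avg (feedback (?N f)) T ?M
    = game_avg (\<lambda>x v. inner_on E (layer_loss \<epsilon> f v) x) T ?M"
    by (rule game_avg_cong) (simp add: feedback_def inner_layer_loss fn)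
  finally have "real m * real T / 4 \<le> \<dots>" .
  \<comment> \<open>The noise is fixed after \<open>f\<close>, so both may depend on the
    learner.\<close>
  moreover obtain v where v: "\<forall>\<tau>. v \<tau> \<in> ?I"
    "game_avg (\<lambda>x v. inner_on E (layer_loss \<epsilon> f v) x) T ?M
      \<le> measure_pmf.expectation (play E A (\<lambda>\<tau>. layer_loss \<epsilon> f (v \<tau>)) T) ?M"
    using fix_noise[OF noisy_game_axioms A] by blast
  ultimately have "\<epsilon> * (real m * real T / 4)
    \<le> \<epsilon> * measure_pmf.expectation (play E A (\<lambda>\<tau>. layer_loss \<epsilon> f (v \<tau>)) T) ?M"
    using \<epsilon>0 by (intro mult_left_mono) auto
  also have "\<dots> \<le> expected_regret E S A (\<lambda>\<tau>. layer_loss \<epsilon> f (v \<tau>)) T"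
    by (rule regret_ge_misses[OF A fn])
  finally have "\<epsilon> * (real m * real T / 4) \<le> \<dots>" .
  moreover have "\<epsilon> * (real m * real T / 4) = (real m)\<^sup>2 * sqrt (real n * real T) / (1600 * ln (real T))"
  proof -
    have "sqrt (real n / real T) * real T = sqrt (real n * real T)"
      using T2 by (simp add: real_sqrt_divide real_sqrt_mult field_simps)
    then show ?thesis by (simp add: \<epsilon>_def \<theta>_def power2_eq_square field_simps)
  qed
  moreover have "layer_loss \<epsilon> f (v \<tau>) e \<in> {0..1}" for \<tau> e
  proof (rule layer_loss_bounds)
    have "v \<tau> \<in> ?I" using v(1) by blast
    then have "\<bar>v \<tau>\<bar> \<le> int K" by auto
    then have "\<theta> * \<bar>real_of_int (v \<tau>)\<bar> \<le> \<theta> * real K"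
      using par(1) by (intro mult_left_mono) auto
    also have "\<dots> \<le> 10 * ln (real T)" by (rule par(6))
    finally show "\<bar>\<epsilon> / real m * real_of_int (v \<tau>)\<bar> \<le> 1 / 4"
      using ln m_pos par(1) by (simp add: \<epsilon>_def abs_mult field_simps)
  qed (use \<epsilon>0 \<epsilon>1 in auto)
  ultimately have "(real m)\<^sup>2 * sqrt (real n * real T) / (1600 * ln (real T))
      \<le> expected_regret E S A (\<lambda>\<tau>. layer_loss \<epsilon> f (v \<tau>)) T"
    and "\<forall>\<tau>. \<forall>e\<in>E. layer_loss \<epsilon> f (v \<tau>) e \<in> {0..1}"
    by (linarith, blast)
  then show ?thesis by (intro exI[of _ "\<lambda>\<tau>. layer_loss \<epsilon> f (v \<tau>)"] conjI)
qed

end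

section \<open>Ranked digraphs\<close>

text \<open>A grading that rises by exactly one along each arc. It fixes the length of a walk by its
  end points, which yields acyclicity and equal path lengths.\<close>

locale ranked_digraph = wf_digraph G for G :: "('v, 'e) pre_digraph" +
  fixes rank :: "'v \<Rightarrow> nat"
  assumes rank_head: "e \<in> arcs G \<Longrightarrow> rank (head G e) = Suc (rank (tail G e))"
begin

lemma rank_awalk: "awalk u p v \<Longrightarrow> rank v = rank u + length p"
  by (induction p arbitrary: u) (auto simp: awalk_Nil_iff awalk_Cons_iff rank_head)

lemma rank_tails: "awalk u p v \<Longrightarrow> map (\<lambda>e. rank (tail G e)) p = [rank u..<rank v]"
proof (induction p arbitrary: u)
  case (Cons e p)
  then have "awalk (head G e) p v" "e \<in> arcs G" "u = tail G e" by (auto simp: awalk_Cons_iff)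
  with Cons.IH[of "head G e"] rank_awalk[of "head G e" p v] show ?case
    by (simp add: rank_head upt_conv_Cons del: upt_Suc)
qed (simp add: awalk_Nil_iff)

lemma acyclic: "\<not> cycle q"
proof
  assume "cycle q"
  then obtain u where "awalk u q u" "q \<noteq> []" by (auto simp: cycle_def)
  then show False using rank_awalk[of u q u] by simp
qed

text \<open>The vertices of a walk have consecutive ranks and hence do not repeat.\<close>

lemma awalk_imp_apath:
  assumes "awalk u p v"
  shows "apath u p v"
proof -
  have "map rank (awalk_verts u p) = [rank u..<Suc (rank v)]" if "awalk u p v" for u p
    using that
  proof (induction p arbitrary: u)
    case (Cons e p)
    then have "awalk (head G e) p v" "e \<in> arcs G" "u = tail G e" by (auto simp: awalk_Cons_iff)
    with Cons.IH[of "head G e"] rank_awalk[of "head G e" p v] show ?case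
      by (simp add: rank_head upt_conv_Cons del: upt_Suc)
  qed (simp add: awalk_Nil_iff)
  from this[OF assms] have "distinct (map rank (awalk_verts u p))" by simp
  then have "distinct (awalk_verts u p)" by (simp only: distinct_map)
  with assms show ?thesis by (simp add: apath_def)
qed

lemma ex1_arc_of_rank:
  assumes p: "awalk u p v" and r: "rank u \<le> r" "r < rank v"
  shows "\<exists>!e. e \<in> set p \<and> rank (tail G e) = r"
proof -
  note tails = rank_tails[OF p]
  have "r \<in> (\<lambda>e. rank (tail G e)) ` set p"
    using r arg_cong[OF tails, of set] by (simp del: set_upt) auto
  moreover have "inj_on (\<lambda>e. rank (tail G e)) (set p)"
    using tails by (metis distinct_map distinct_upt)
  ultimately show ?thesis by (auto simp: inj_on_def)
qed

text \<open>A path from rank 0 crosses every level below the rank of \<open>t\<close> exactly once.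
  The even levels serve as the layers: in the graphs below these arcs leave the hubs, where the arm
  is chosen.\<close>

lemma layered_path_actions:
  assumes fin: "finite (arcs G)" and rank: "rank s = 0" "\<And>i. i < m \<Longrightarrow> 2 * i < rank t"
    and a: "\<And>i j. i < m \<Longrightarrow> j < n \<Longrightarrow> a i j \<in> arcs G \<and> rank (tail G (a i j)) = 2 * i"
    and inj: "\<And>i. inj (a i)"
    and choice: "\<And>f. (\<And>i. i < m \<Longrightarrow> f i < n) \<Longrightarrow> \<exists>p. awalk s p t \<and> (\<forall>i<m. a i (f i) \<in> set p)"
    and mn: "0 < m" "2 \<le> n"
  shows "layered_actions (arcs G) (path_actions G s t) m n
    (\<lambda>i. {e \<in> arcs G. rank (tail G e) = 2 * i}) a"
proof
  let ?S = "path_actions G s t"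
  show "finite ?S"
  proof (rule finite_subset)
    show "?S \<subseteq> (\<lambda>X e. of_bool (e \<in> X)) ` Pow (arcs G)"
    proof
      fix x assume x: "x \<in> ?S"
      have "x = (\<lambda>e. of_bool (e \<in> {e \<in> arcs G. x e = 1}))"
      proof
        fix e show "x e = of_bool (e \<in> {e \<in> arcs G. x e = 1})"
          using x by (cases "e \<in> arcs G") (auto simp: path_actions_def)
      qed
      then show "x \<in> (\<lambda>X e. of_bool (e \<in> X)) ` Pow (arcs G)" by blast
    qed
  qed (simp add: fin)
  show "(\<Sum>e\<in>{e \<in> arcs G. rank (tail G e) = 2 * i}. x e) = 1" if x: "x \<in> ?S" and i: "i < m" for x i
  proof -
    obtain p where p: "apath s p t" "{e \<in> arcs G. x e = 1} = set p"
      using x by (auto simp: path_actions_def)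
    have "\<exists>!e. e \<in> set p \<and> rank (tail G e) = 2 * i"
      by (rule ex1_arc_of_rank[of s p t]) (use p rank i in \<open>auto simp: apath_def\<close>)
    then obtain e where e: "e \<in> set p \<and> rank (tail G e) = 2 * i"
      and uniq: "\<forall>e'. e' \<in> set p \<and> rank (tail G e') = 2 * i \<longrightarrow> e' = e"
      by (rule ex1E)
    have "(\<Sum>e\<in>{e \<in> arcs G. rank (tail G e) = 2 * i}. x e) = (\<Sum>e\<in>{e}. x e)"
    proof (rule sum.mono_neutral_right)
      show "{e} \<subseteq> {e \<in> arcs G. rank (tail G e) = 2 * i}" using e p(2) by auto
      show "\<forall>e'\<in>{e \<in> arcs G. rank (tail G e) = 2 * i} - {e}. x e' = 0"
      proof
        fix e' assume e': "e' \<in> {e \<in> arcs G. rank (tail G e) = 2 * i} - {e}"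
        then have "e' \<notin> set p" using uniq by blast
        then have "x e' \<noteq> 1" using e' p(2) by blast
        then show "x e' = 0" using e' x by (auto simp: path_actions_def)
      qed
    qed (simp add: fin)
    also have "\<dots> = 1" using e p(2) by auto
    finally show ?thesis .
  qed
  show "\<exists>x\<in>?S. \<forall>i<m. x (a i (f i)) = 1" if f: "\<And>i. i < m \<Longrightarrow> f i < n" for f
  proof -
    obtain p where p: "awalk s p t" "\<forall>i<m. a i (f i) \<in> set p" using choice[of f] f by auto
    then have "set p \<subseteq> arcs G" by (auto simp: awalk_def)
    then have "(\<lambda>e. of_bool (e \<in> set p)) \<in> ?S"
      using awalk_imp_apath[OF p(1)] by (auto simp: path_actions_def intro!: exI[of _ p])
    with p(2) show ?thesis by (intro bexI) auto
  qed
  show "inj_on (a i) {..<n}" for i using inj by (rule inj_on_subset) simp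
qed (use fin a mn in \<open>auto simp: path_actions_def\<close>)

end

section \<open>The graphs\<close>

text \<open>
  The layered graph with \<open>m\<close> layers of \<open>n\<close> intermediate vertices, padded to arbitrary \<open>k\<close> and \<open>d\<close>:
  the \<open>r\<close> pendant arcs \<open>Enter 0 j\<close> with \<open>j \<ge> n\<close> lie on no path to the target, and for odd \<open>k\<close> the
  flag \<open>b\<close> adds the arc \<open>Enter m 0\<close> behind the last layer, whose head \<open>Mid m 0\<close> becomes the target.
\<close>

definition padded_digraph :: "nat \<Rightarrow> nat \<Rightarrow> nat \<Rightarrow> bool \<Rightarrow> (layer_vertex, layer_arc) pre_digraph" where
  "padded_digraph m n r b =
     \<lparr>verts = {Hub i |i. i \<le> m} \<union> {Mid i j |i j. i < m \<and> j < n} \<union>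
              {Mid 0 j |j. n \<le> j \<and> j < n + r} \<union> {Mid m 0 |u::unit. b},
      arcs = {Enter i j |i j. i < m \<and> j < n} \<union> {Leave i j |i j. i < m \<and> j < n} \<union>
             {Enter 0 j |j. n \<le> j \<and> j < n + r} \<union> {Enter m 0 |u::unit. b},
      tail = layer_tail, head = layer_head\<rparr>"

lemma padded_simps [simp]:
  "Enter i j \<in> arcs (padded_digraph m n r b) \<longleftrightarrow> i < m \<and> j < n \<or> i = 0 \<and> n \<le> j \<and> j < n + r \<or> i = m \<and> j = 0 \<and> b"
  "Leave i j \<in> arcs (padded_digraph m n r b) \<longleftrightarrow> i < m \<and> j < n"
  "Hub i \<in> verts (padded_digraph m n r b) \<longleftrightarrow> i \<le> m"
  "Mid i j \<in> verts (padded_digraph m n r b) \<longleftrightarrow> i < m \<and> j < n \<or> i = 0 \<and> n \<le> j \<and> j < n + r \<or> i = m \<and> j = 0 \<and> b"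
  "tail (padded_digraph m n r b) = layer_tail" "head (padded_digraph m n r b) = layer_head"
  by (auto simp: padded_digraph_def)

definition padded_target :: "nat \<Rightarrow> bool \<Rightarrow> layer_vertex" where
  "padded_target m b = (if b then Mid m 0 else Hub m)"

fun layer_rank :: "layer_vertex \<Rightarrow> nat" where
  "layer_rank (Hub i) = 2 * i"
| "layer_rank (Mid i j) = Suc (2 * i)"

locale padded =
  fixes m n r :: nat and b :: bool
  assumes m_pos: "0 < m" and n_ge: "2 \<le> n"
begin

abbreviation "G \<equiv> padded_digraph m n r b"

sublocale ranked_digraph G layer_rank
  by unfold_locales (use m_pos n_ge in \<open>auto simp: padded_digraph_def\<close>)

lemma finite_padded: "finite (arcs G)" "finite (verts G)" and card_padded: "card (arcs G) = 2 * m * n + r + of_bool b"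
proof -
  have arcs: "arcs G = case_prod Enter ` ({..<m} \<times> {..<n}) \<union> case_prod Leave ` ({..<m} \<times> {..<n})
      \<union> Enter 0 ` {n..<n + r} \<union> (if b then {Enter m 0} else {})"
    by (auto simp: padded_digraph_def)
  show "finite (arcs G)" by (simp add: arcs)
  have "verts G = Hub ` {..m} \<union> case_prod Mid ` ({..<m} \<times> {..<n})
      \<union> Mid 0 ` {n..<n + r} \<union> (if b then {Mid m 0} else {})"
    by (auto simp: padded_digraph_def)
  then show "finite (verts G)" by simp
  have "card (case_prod Enter ` ({..<m} \<times> {..<n})) = m * n"
    "card (case_prod Leave ` ({..<m} \<times> {..<n})) = m * n" "card (Enter 0 ` {n..<n + r}) = r"
    by (subst card_image; auto simp: inj_on_def)+
  then show "card (arcs G) = 2 * m * n + r + of_bool b"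
    unfolding arcs using m_pos by (subst card_Un_disjoint; (subst card_Un_disjoint)?; (subst card_Un_disjoint)?; auto)
qed

sublocale fin_digraph G
  by unfold_locales (simp_all add: finite_padded)

lemma nomulti_padded: "nomulti_digraph G"
proof
  fix e1 e2 assume "e1 \<in> arcs G" "e2 \<in> arcs G" "arc_to_ends G e1 = arc_to_ends G e2"
  then show "e1 = e2"
    by (cases e1; cases e2) (auto simp: arc_to_ends_def)
qed

definition hub_walk :: "(nat \<Rightarrow> nat) \<Rightarrow> nat \<Rightarrow> layer_arc list" where
  "hub_walk f i = concat (map (\<lambda>i. [Enter i (f i), Leave i (f i)]) [0..<i])"

lemma awalk_hub_walk:
  assumes "\<And>i. i < m \<Longrightarrow> f i < n" "i \<le> m"
  shows "awalk (Hub 0) (hub_walk f i) (Hub i)"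
  using assms(2)
proof (induction i)
  case 0
  then show ?case by (simp add: hub_walk_def awalk_Nil_iff)
next
  case (Suc i)
  then have "awalk (Hub i) [Enter i (f i), Leave i (f i)] (Hub (Suc i))"
    using assms(1) by (simp add: awalk_Cons_iff awalk_Nil_iff)
  then have "awalk (Hub 0) (hub_walk f i @ [Enter i (f i), Leave i (f i)]) (Hub (Suc i))"
    using Suc by (intro awalk_appendI) auto
  then show ?case by (simp add: hub_walk_def)
qed

lemma reachable_padded:
  assumes "v \<in> verts G"
  shows "Hub 0 \<rightarrow>\<^sup>*\<^bsub>G\<^esub> v"
proof -
  have hub: "Hub 0 \<rightarrow>\<^sup>*\<^bsub>G\<^esub> Hub i" if "Hub i \<in> verts G" for i
    using awalk_hub_walk[of "\<lambda>_. 0" i] that n_ge by (intro reachable_awalkI) auto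
  show ?thesis
  proof (cases v)
    case (Mid i j)
    then have e: "Enter i j \<in> arcs G" "Hub i \<in> verts G" using assms by auto
    then have "awalk (Hub i) [Enter i j] v"
      using Mid assms by (simp add: awalk_Cons_iff awalk_Nil_iff)
    then have "Hub i \<rightarrow>\<^sup>*\<^bsub>G\<^esub> v" by (rule reachable_awalkI)
    with hub[OF e(2)] show ?thesis by (rule reachable_trans)
  qed (use hub assms in auto)
qed

lemma awalk_target:
  assumes "\<And>i. i < m \<Longrightarrow> f i < n"
  shows "\<exists>p. awalk (Hub 0) p (padded_target m b) \<and> (\<forall>i<m. Enter i (f i) \<in> set p)"
proof -
  have "awalk (Hub m) (if b then [Enter m 0] else []) (padded_target m b)"
    by (simp add: padded_target_def pre_digraph.awalk_def pre_digraph.cas.simps)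
  moreover have "awalk (Hub 0) (hub_walk f m) (Hub m)"
    by (rule awalk_hub_walk) (use assms in auto)
  ultimately have "awalk (Hub 0) (hub_walk f m @ (if b then [Enter m 0] else [])) (padded_target m b)"
    by (rule awalk_appendI[rotated])
  moreover have "\<forall>i<m. Enter i (f i) \<in> set (hub_walk f m)"
    by (auto simp: hub_walk_def)
  ultimately show ?thesis
    by (intro exI[of _ "hub_walk f m @ (if b then [Enter m 0] else [])"] conjI) simp_all
qed

lemma layered_actions_padded:
  "layered_actions (arcs G) (path_actions G (Hub 0) (padded_target m b)) m n
    (\<lambda>i. {e \<in> arcs G. layer_rank (tail G e) = 2 * i}) Enter"
proof (rule layered_path_actions)
  show "2 * i < layer_rank (padded_target m b)" if "i < m" for i
    using that by (simp add: padded_target_def)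
  show "Enter i j \<in> arcs G \<and> layer_rank (tail G (Enter i j)) = 2 * i" if "i < m" "j < n" for i j
    using that by simp
  show "\<exists>p. awalk (Hub 0) p (padded_target m b) \<and> (\<forall>i<m. Enter i (f i) \<in> set p)"
    if "\<And>i. i < m \<Longrightarrow> f i < n" for f
    using that by (rule awalk_target)
qed (simp_all add: finite_padded m_pos n_ge inj_on_def)

end

section \<open>Graphs for all \<open>k\<close> and \<open>d\<close>\<close>

lemma (in wf_digraph) connected_from_root:
  assumes "s \<in> verts G" "\<And>v. v \<in> verts G \<Longrightarrow> s \<rightarrow>\<^sup>* v"
  shows "Digraph_Component.connected G"
proof (rule connectedI)
  interpret sG: pair_wf_digraph "mk_symmetric G" ..
  fix u v assume "u \<in> verts G" "v \<in> verts G"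
  then have su: "s \<rightarrow>\<^sup>*\<^bsub>mk_symmetric G\<^esub> u" and sv: "s \<rightarrow>\<^sup>*\<^bsub>mk_symmetric G\<^esub> v"
    by (simp_all add: assms(2) reachable_mk_symmetricI)
  show "u \<rightarrow>\<^sup>*\<^bsub>mk_symmetric G\<^esub> v"
    by (rule sG.reachable_trans[OF symmetric_reachable[OF symmetric_mk_symmetric su] sv])
qed (use assms in auto)

text \<open>For \<open>k = 1\<close> every path is a single arc, so \<open>d\<close> arcs force parallel arcs.\<close>

definition parallel_digraph :: "nat \<Rightarrow> (layer_vertex, layer_arc) pre_digraph" where
  "parallel_digraph d = \<lparr>verts = {Hub 0, Hub 1}, arcs = Enter 0 ` {..<d},
     tail = (\<lambda>_. Hub 0), head = (\<lambda>_. Hub 1)\<rparr>"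

text \<open>Bundles the purely graph-theoretic demands of the theorem, so that the bandit part can
  be supplied separately.\<close>

definition layered_path_graph ::
    "nat \<Rightarrow> nat \<Rightarrow> (layer_vertex, layer_arc) pre_digraph \<Rightarrow> layer_vertex \<Rightarrow> layer_vertex \<Rightarrow> bool" where
  "layered_path_graph k d G s t \<longleftrightarrow>
    fin_digraph G \<and> (k \<ge> 2 \<longrightarrow> nomulti_digraph G) \<and>
    Digraph_Component.connected G \<and> (\<nexists>q. pre_digraph.cycle G q) \<and>
    card (arcs G) = d \<and> s \<in> verts G \<and> t \<in> verts G \<and>
    (\<exists>q. pre_digraph.apath G s q t) \<and>
    (\<forall>q. pre_digraph.apath G s q t \<longrightarrow> length q = k) \<and>
    (even k \<and> k dvd d \<longrightarrow> G = layered_digraph k d \<and> s = Hub 0 \<and> t = Hub (k div 2))"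

text \<open>One layer with \<open>d\<close> arms. All tails have rank 0, hence the
  \<open>0 = 2 * i\<close> in the layer set; for \<open>i = 0\<close> it consists of all
  arcs.\<close>

lemma parallel_graph:
  assumes "2 \<le> d"
  shows "layered_path_graph 1 d (parallel_digraph d) (Hub 0) (Hub 1)"
    and "layered_actions (arcs (parallel_digraph d))
      (path_actions (parallel_digraph d) (Hub 0) (Hub 1)) 1 d
      (\<lambda>i. {e \<in> arcs (parallel_digraph d). (0::nat) = 2 * i}) Enter"
proof -
  let ?G = "parallel_digraph d" and ?rank = "\<lambda>v. if v = Hub 0 then 0 else 1 :: nat"
  interpret ranked_digraph ?G ?rank
    by unfold_locales (auto simp: parallel_digraph_def)
  interpret fin_digraph ?G
    by unfold_locales (auto simp: parallel_digraph_def)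
  have walk: "awalk (Hub 0) [Enter 0 j] (Hub 1)" if "j < d" for j
    using that by (simp add: parallel_digraph_def pre_digraph.awalk_def pre_digraph.cas.simps)
  have "Hub 0 \<rightarrow>\<^sup>*\<^bsub>?G\<^esub> Hub 1"
    using walk[of 0] assms by (intro reachable_awalkI) auto
  moreover have verts: "verts ?G = {Hub 0, Hub 1}" by (simp add: parallel_digraph_def)
  moreover have "Hub 0 \<rightarrow>\<^sup>*\<^bsub>?G\<^esub> Hub 0" by (rule reachable_refl) (simp add: verts)
  ultimately have "Hub 0 \<rightarrow>\<^sup>*\<^bsub>?G\<^esub> v" if "v \<in> verts ?G" for v
    using that by (metis insertE singletonD)
  then have "Digraph_Component.connected ?G"
    by (intro connected_from_root[of "Hub 0"]) (simp_all add: verts)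
  moreover have "length q = 1" if "apath (Hub 0) q (Hub 1)" for q
    using that rank_awalk[of "Hub 0" q "Hub 1"] by (simp add: apath_def)
  moreover have "\<exists>q. apath (Hub 0) q (Hub 1)"
    using awalk_imp_apath[OF walk[of 0]] assms by auto
  moreover have "card (arcs ?G) = d"
    by (simp add: parallel_digraph_def card_image inj_on_def)
  ultimately show "layered_path_graph 1 d ?G (Hub 0) (Hub 1)"
    using fin_digraph acyclic by (simp add: layered_path_graph_def) (simp add: parallel_digraph_def)
  have "layered_actions (arcs ?G) (path_actions ?G (Hub 0) (Hub 1)) 1 d
    (\<lambda>i. {e \<in> arcs ?G. ?rank (tail ?G e) = 2 * i}) Enter"
  proof (rule layered_path_actions)
    show "\<exists>p. awalk (Hub 0) p (Hub 1) \<and> (\<forall>i<1. Enter i (f i) \<in> set p)"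
      if "\<And>i. i < 1 \<Longrightarrow> f i < d" for f
      using walk[of "f 0"] that by (intro exI[of _ "[Enter 0 (f 0)]"]) auto
  qed (use assms in \<open>auto simp: parallel_digraph_def inj_on_def\<close>)
  then show "layered_actions (arcs ?G) (path_actions ?G (Hub 0) (Hub 1)) 1 d
    (\<lambda>i. {e \<in> arcs ?G. (0::nat) = 2 * i}) Enter"
    by (simp add: parallel_digraph_def)
qed

lemma padded_graph:
  fixes k d :: nat
  defines "m \<equiv> k div 2" and "n \<equiv> d div k"
  defines "r \<equiv> d - 2 * m * n - k mod 2" and "b \<equiv> odd k"
  assumes k: "2 \<le> k" "2 * k \<le> d"
  shows "layered_path_graph k d (padded_digraph m n r b) (Hub 0) (padded_target m b)"
    and "layered_actions (arcs (padded_digraph m n r b))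
      (path_actions (padded_digraph m n r b) (Hub 0) (padded_target m b)) m n
      (\<lambda>i. {e \<in> arcs (padded_digraph m n r b). layer_rank (tail (padded_digraph m n r b) e) = 2 * i})
      Enter"
proof -
  \<comment> \<open>This is where \<open>2 * k \<le> d\<close> is used: every layer has at least two
    arms.\<close>
  have n: "2 \<le> n" using k div_le_mono[of "2 * k" d k] by (simp add: n_def)
  interpret padded m n r b
    by unfold_locales (use k n in \<open>auto simp: m_def\<close>)
  show "layered_actions (arcs G) (path_actions G (Hub 0) (padded_target m b)) m n
      (\<lambda>i. {e \<in> arcs G. layer_rank (tail G e) = 2 * i}) Enter"
    by (rule layered_actions_padded)
  have k_eq: "k = 2 * m + k mod 2" by (simp add: m_def)
  \<comment> \<open>The layers and the extra arc fit into \<open>d\<close>, so the natural-number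
    subtractions in \<open>r\<close> are exact.\<close>
  have "k mod 2 * 1 \<le> k mod 2 * n" using n by (intro mult_left_mono) auto
  then have "2 * m * n + k mod 2 \<le> (2 * m + k mod 2) * n" by (simp add: distrib_right)
  also have "\<dots> = k * n" using k_eq by simp
  also have "\<dots> \<le> d" by (simp add: n_def)
  finally have "2 * m * n + k mod 2 \<le> d" .
  moreover have "of_bool b = k mod 2" by (simp add: b_def odd_iff_mod_2_eq_one)
  ultimately have "2 * m * n + r + of_bool b = d" unfolding r_def by linarith
  then have "card (arcs G) = d" by (simp only: card_padded)
  moreover have "length q = k" if "apath (Hub 0) q (padded_target m b)" for q
  proof -
    have "layer_rank (padded_target m b) = length q"
      using that rank_awalk[of "Hub 0" q] by (simp add: apath_def)
    moreover have "layer_rank (padded_target m b) = k"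
      using k_eq by (auto simp: padded_target_def b_def odd_iff_mod_2_eq_one)
    ultimately show ?thesis by simp
  qed
  moreover obtain p where "awalk (Hub 0) p (padded_target m b)"
    using awalk_target[of "\<lambda>_. 0"] n by auto
  moreover from this have "apath (Hub 0) p (padded_target m b)" by (rule awalk_imp_apath)
  moreover have "Digraph_Component.connected G"
    by (rule connected_from_root[OF _ reachable_padded]) simp_all
  \<comment> \<open>Without a remainder both kinds of padding vanish.\<close>
  moreover have "G = layered_digraph k d \<and> padded_target m b = Hub (k div 2)" if "even k" "k dvd d"
  proof -
    have "2 * m = k" using that(1) by (simp add: m_def)
    then have "r = 0" "\<not> b" using that by (simp_all add: r_def b_def n_def)
    then show ?thesis
      by (auto simp: padded_digraph_def layered_digraph_def padded_target_def m_def n_def)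
  qed
  moreover have "padded_target m b \<in> verts G" by (simp add: padded_target_def)
  ultimately show "layered_path_graph k d G (Hub 0) (padded_target m b)"
    using fin_digraph nomulti_padded acyclic unfolding layered_path_graph_def by auto
qed

text \<open>The first two inequalities carry the rate from \<open>m\<close> and \<open>n\<close>
  over to \<open>k\<close> and \<open>d\<close>, the third one the condition on the horizon. The 3
  is attained at \<open>k = 3\<close>; the 6 doubles it, since \<open>d\<close> is less than twice
  \<open>k * (d div k)\<close>.\<close>

lemma exists_layered_path_graph:
  assumes "0 < k" "2 * k \<le> d"
  shows "\<exists>G s t m n B a. layered_path_graph k d G s t \<and>
    layered_actions (arcs G) (path_actions G s t) m n B a \<and>
    k \<le> 3 * m \<and> d \<le> 6 * m * n \<and> m\<^sup>2 * n \<le> k * d"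
proof (cases "k = 1")
  case True
  then have "layered_path_graph k d (parallel_digraph d) (Hub 0) (Hub 1) \<and>
    layered_actions (arcs (parallel_digraph d))
      (path_actions (parallel_digraph d) (Hub 0) (Hub 1)) 1 d
      (\<lambda>i. {e \<in> arcs (parallel_digraph d). (0::nat) = 2 * i}) Enter \<and>
    k \<le> 3 * 1 \<and> d \<le> 6 * 1 * d \<and> 1\<^sup>2 * d \<le> k * d"
    using parallel_graph[of d] assms by simp
  then show ?thesis by blast
next
  case False
  let ?m = "k div 2" and ?n = "d div k"
  have k2: "2 \<le> k" using False assms(1) by simp
  have k3: "k \<le> 3 * ?m" using k2 by (cases "even k") (auto elim!: evenE oddE)
  have n: "1 \<le> ?n" using assms div_le_mono[of k d k] by simp
  have "d = k * ?n + d mod k" by simp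
  also have "\<dots> \<le> k * ?n + k * ?n"
  proof (rule add_left_mono)
    have "d mod k \<le> k * 1" using assms(1) by (simp add: less_imp_le)
    also have "\<dots> \<le> k * ?n" by (rule mult_left_mono[OF n]) simp
    finally show "d mod k \<le> k * ?n" .
  qed
  also have "\<dots> = 2 * (k * ?n)" by simp
  also have "\<dots> \<le> 2 * (3 * ?m * ?n)" by (intro mult_left_mono mult_right_mono k3) auto
  finally have d6: "d \<le> 6 * ?m * ?n" by simp
  have "?m * (?m * ?n) \<le> k * (k * ?n)" by (intro mult_mono) auto
  also have "\<dots> \<le> k * d" by (intro mult_left_mono) auto
  finally have "?m\<^sup>2 * ?n \<le> k * d" by (simp add: power2_eq_square mult.assoc)
  with padded_graph[OF k2 assms(2)] k3 d6 show ?thesis by blast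
qed

text \<open>After squaring, the constant is 27 * 6 = 162, which is at most 169, the square of
  13.\<close>

lemma rate_le:
  fixes k d m n T :: nat
  assumes "k \<le> 3 * m" "d \<le> 6 * m * n"
  shows "real k powr (3/2) * sqrt (real d * real T) \<le> 13 * ((real m)\<^sup>2 * sqrt (real n * real T))"
proof -
  have "real k powr (3/2) = sqrt (real k ^ 3)"
    by (simp add: powr_half_sqrt[symmetric] powr_powr flip: powr_numeral)
  then have "real k powr (3/2) * sqrt (real d * real T) = sqrt (real (k ^ 3 * (d * T)))"
    by (simp add: real_sqrt_mult)
  also have "k ^ 3 * (d * T) \<le> (3 * m) ^ 3 * (6 * m * n * T)"
    using assms by (intro mult_mono power_mono) auto
  then have "sqrt (real (k ^ 3 * (d * T))) \<le> sqrt (real ((3 * m) ^ 3 * (6 * m * n * T)))"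
    by (intro real_sqrt_le_mono) (simp only: of_nat_le_iff)
  also have "(3 * m) ^ 3 * (6 * m * n * T) \<le> (13 * m\<^sup>2)\<^sup>2 * (n * T)"
    by (simp add: power_mult_distrib power_numeral_reduce)
  then have "sqrt (real ((3 * m) ^ 3 * (6 * m * n * T))) \<le> sqrt (real ((13 * m\<^sup>2)\<^sup>2 * (n * T)))"
    by (intro real_sqrt_le_mono) (simp only: of_nat_le_iff)
  also have "\<dots> = 13 * ((real m)\<^sup>2 * sqrt (real n * real T))"
  proof -
    have "real ((13 * m\<^sup>2)\<^sup>2 * (n * T)) = (13 * (real m)\<^sup>2)\<^sup>2 * (real n * real T)" by simp
    then show ?thesis by (simp only: real_sqrt_mult real_sqrt_abs) simp
  qed
  finally show ?thesis .
qed

theorem theorem2: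
  shows "\<exists>c::real. \<exists>p::nat. c > 0 \<and>
    (\<forall>k d::nat. 0 < k \<and> 0 < d \<and> real k \<le> real d / 2 \<longrightarrow>
      (\<exists>(G :: (layer_vertex, layer_arc) pre_digraph) s t.
        fin_digraph G \<and> (k \<ge> 2 \<longrightarrow> nomulti_digraph G) \<and>
        Digraph_Component.connected G \<and> (\<nexists>q. pre_digraph.cycle G q) \<and>
        card (arcs G) = d \<and> s \<in> verts G \<and> t \<in> verts G \<and>
        (\<exists>q. pre_digraph.apath G s q t) \<and>
        (\<forall>q. pre_digraph.apath G s q t \<longrightarrow> length q = k) \<and>
        (even k \<and> k dvd d \<longrightarrow> G = layered_digraph k d \<and> s = Hub 0 \<and> t = Hub (k div 2)) \<and>
        (\<forall>T::nat. T \<ge> k * d \<longrightarrow>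
          (\<forall>A. plays_in (path_actions G s t) A \<longrightarrow>
            (\<exists>l :: nat \<Rightarrow> layer_arc \<Rightarrow> real.
              (\<forall>\<tau><T. \<forall>e\<in>arcs G. l \<tau> e \<in> {0..1}) \<and>
              expected_regret (arcs G) (path_actions G s t) A l T
                \<ge> c * (real k powr (3/2) * sqrt (real d * real T)) / ln (real T) ^ p)))))"
\<comment> \<open>20800 = 13 * 1600, from \<open>rate_le\<close> and
  \<open>regret_lower_bound\<close>; a single logarithm is lost.\<close>
proof (rule exI[of _ "1 / 20800"], rule exI[of _ 1], intro conjI allI impI)
  fix k d :: nat
  assume "0 < k \<and> 0 < d \<and> real k \<le> real d / 2"
  then have kd: "0 < k" "2 * k \<le> d" by auto
  obtain G s t m n B a where G: "layered_path_graph k d G s t"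
    and act: "layered_actions (arcs G) (path_actions G s t) m n B a"
    and mn: "k \<le> 3 * m" "d \<le> 6 * m * n" "m\<^sup>2 * n \<le> k * d"
    using exists_layered_path_graph[OF kd] by blast
  have bound: "\<exists>l. (\<forall>\<tau><T. \<forall>e\<in>arcs G. l \<tau> e \<in> {0..1}) \<and>
      expected_regret (arcs G) (path_actions G s t) A l T
        \<ge> 1 / 20800 * (real k powr (3/2) * sqrt (real d * real T)) / ln (real T) ^ 1"
    if T: "T \<ge> k * d" and A: "plays_in (path_actions G s t) A" for T A
  proof -
    have "m\<^sup>2 * n \<le> T" using mn(3) T by simp
    from layered_actions.regret_lower_bound[OF act A this]
    obtain l where l: "\<forall>\<tau>. \<forall>e\<in>arcs G. l \<tau> e \<in> {0..1}"
      and regret: "(real m)\<^sup>2 * sqrt (real n * real T) / (1600 * ln (real T))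
        \<le> expected_regret (arcs G) (path_actions G s t) A l T"
      by blast
    have "1 * 2 \<le> k * d" using kd by (intro mult_mono) auto
    then have "0 \<le> ln (real T)" using T by simp
    then have "real k powr (3/2) * sqrt (real d * real T) / ln (real T)
        \<le> 13 * ((real m)\<^sup>2 * sqrt (real n * real T)) / ln (real T)"
      by (intro divide_right_mono rate_le mn)
    with regret have "1 / 20800 * (real k powr (3/2) * sqrt (real d * real T)) / ln (real T) ^ 1
        \<le> expected_regret (arcs G) (path_actions G s t) A l T"
      by simp
    with l show ?thesis by auto
  qed
  show "\<exists>(G :: (layer_vertex, layer_arc) pre_digraph) s t.
        fin_digraph G \<and> (k \<ge> 2 \<longrightarrow> nomulti_digraph G) \<and>
        Digraph_Component.connected G \<and> (\<nexists>q. pre_digraph.cycle G q) \<and>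
        card (arcs G) = d \<and> s \<in> verts G \<and> t \<in> verts G \<and>
        (\<exists>q. pre_digraph.apath G s q t) \<and>
        (\<forall>q. pre_digraph.apath G s q t \<longrightarrow> length q = k) \<and>
        (even k \<and> k dvd d \<longrightarrow> G = layered_digraph k d \<and> s = Hub 0 \<and> t = Hub (k div 2)) \<and>
        (\<forall>T::nat. T \<ge> k * d \<longrightarrow>
          (\<forall>A. plays_in (path_actions G s t) A \<longrightarrow>
            (\<exists>l :: nat \<Rightarrow> layer_arc \<Rightarrow> real.
              (\<forall>\<tau><T. \<forall>e\<in>arcs G. l \<tau> e \<in> {0..1}) \<and>
              expected_regret (arcs G) (path_actions G s t) A l T
                \<ge> 1 / 20800 * (real k powr (3/2) * sqrt (real d * real T)) / ln (real T) ^ 1)))"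
    using G bound unfolding layered_path_graph_def
    by (intro exI[of _ G] exI[of _ s] exI[of _ t]) simp
qed simp

end
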